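(* Let $0\le l<u<\infty$, $\sigma>0$, $x\in[l,u]$ and $\theta_0\in\mathbb{R}$. Let $f:[l,u]\to\mathbb{R}$ be Lipschitz continuous on $[l,u]$ and not identically $0$ on $[l,u]$. Let $X=\{X_t\}_{t\ge0}$ be the solution of the reflected stochastic differential equation $$\mathrm{d}X_t=\theta_0 f(X_t)\,\mathrm{d}t+\sigma\,\mathrm{d}W_t+\mathrm{d}L_t-\mathrm{d}R_t,\qquad X_0=x,$$ with reflecting barriers $l$ and $u$. Let $$\tilde\theta_T=\frac{\int_0^Tf(X_t)\big(\mathrm{d}X_t-\mathrm{d}L_t+\mathrm{d}R_t\big)}{\int_0^Tf^2(X_t)\,\mathrm{d}t}$$ be the least squares estimator of $\theta_0$. Then $\tilde\theta_T\to\theta_0$ in probability as $T\to\infty$.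
   Context: $(\Omega,\mathcal{F},\mathbb{P},\{\mathcal{F}_t\}_{t\ge0})$ is a filtered probability space carrying a one-dimensional standard $\{\mathcal{F}_t\}$-Brownian motion $W$. The reflected equation is understood as follows: $X$ is the unique strong solution, it is continuous and adapted with $X_t\in[l,u]$ for all $t\ge0$; $L$ and $R$ are the minimal continuous nondecreasing adapted processes with $L_0=R_0=0$ keeping $X$ in $[l,u]$, and they increase only when $X$ is at $l$ and at $u$ respectively: $\int_0^\infty I_{\{X_t>l\}}\,\mathrm{d}L_t=0$ and $\int_0^\infty I_{\{X_t<u\}}\,\mathrm{d}R_t=0$. On the event $\{\int_0^Tf^2(X_t)\,\mathrm{d}t=0\}$ set $\tilde\theta_T=0$ by convention. *)

theory Defs
  imports "HOL-Probability.Probability"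
begin

text \<open>
  Processes are curried functions \<open>real \<Rightarrow> 'a \<Rightarrow> real\<close>, of which only the times \<open>t \<ge> 0\<close> matter.
  A filtration indexed by \<open>t \<ge> 0\<close> is extended to negative times in an arbitrary monotone way
  (say by \<open>F 0\<close>), so that the library's notions of filtration and stopping time apply.
  Completeness and right-continuity of the filtration are not required.
\<close>

definition filtered_prob_space :: "'a measure \<Rightarrow> (real \<Rightarrow> 'a measure) \<Rightarrow> bool" where
  "filtered_prob_space M F \<longleftrightarrow>
     prob_space M \<and> filtration (space M) F \<and> (\<forall>t. subalgebra M (F t))"

definition adapted :: "(real \<Rightarrow> 'a measure) \<Rightarrow> (real \<Rightarrow> 'a \<Rightarrow> real) \<Rightarrow> bool" where
  "adapted F Z \<longleftrightarrow> (\<forall>t\<ge>0. Z t \<in> borel_measurable (F t))"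

definition continuous_process :: "'a measure \<Rightarrow> (real \<Rightarrow> 'a \<Rightarrow> real) \<Rightarrow> bool" where
  "continuous_process M Z \<longleftrightarrow> (\<forall>\<omega>\<in>space M. continuous_on {0..} (\<lambda>t. Z t \<omega>))"

definition brownian_motion ::
  "'a measure \<Rightarrow> (real \<Rightarrow> 'a measure) \<Rightarrow> (real \<Rightarrow> 'a \<Rightarrow> real) \<Rightarrow> bool" where
  "brownian_motion M F W \<longleftrightarrow>
     adapted F W \<and> continuous_process M W \<and> (AE \<omega> in M. W 0 \<omega> = 0) \<and>
     (\<forall>s t. 0 \<le> s \<and> s < t \<longrightarrow>
        prob_space.indep_set M (sets (F s))
          (sets (vimage_algebra (space M) (\<lambda>\<omega>. W t \<omega> - W s \<omega>) borel)) \<and>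
        distributed M lborel (\<lambda>\<omega>. W t \<omega> - W s \<omega>) (normal_density 0 (sqrt (t - s))))"

definition increasing_process ::
  "'a measure \<Rightarrow> (real \<Rightarrow> 'a measure) \<Rightarrow> (real \<Rightarrow> 'a \<Rightarrow> real) \<Rightarrow> bool" where
  "increasing_process M F A \<longleftrightarrow>
     adapted F A \<and> continuous_process M A \<and>
     (\<forall>\<omega>\<in>space M. A 0 \<omega> = 0 \<and> mono_on {0..} (\<lambda>t. A t \<omega>))"

text \<open>The Lebesgue-Stieltjes measure \<open>dA\<^sub>t\<close> on \<open>[0, \<infinity>)\<close> of a path of an increasing process;
  the path is extended by its value at \<open>0\<close>, so negative times carry no mass.\<close>

definition stieltjes :: "(real \<Rightarrow> 'a \<Rightarrow> real) \<Rightarrow> 'a \<Rightarrow> real measure" where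
  "stieltjes A \<omega> = interval_measure (\<lambda>t. A (max 0 t) \<omega>)"

text \<open>\<open>dX = b(X) dt + \<sigma> dW + dL - dR\<close>, \<open>X\<^sub>0 = x\<close>, reflected at \<open>l\<close> and \<open>u\<close>. The diffusion coefficient
  is constant, so the equation is a pathwise identity. That \<open>L\<close> and \<open>R\<close> grow only while \<open>X\<close> is at
  the respective barrier is what singles out the minimal pushing processes.\<close>

definition reflected_SDE ::
  "'a measure \<Rightarrow> (real \<Rightarrow> 'a measure) \<Rightarrow> (real \<Rightarrow> 'a \<Rightarrow> real) \<Rightarrow> (real \<Rightarrow> real) \<Rightarrow> real \<Rightarrow>
   real \<Rightarrow> real \<Rightarrow> real \<Rightarrow> (real \<Rightarrow> 'a \<Rightarrow> real) \<Rightarrow> (real \<Rightarrow> 'a \<Rightarrow> real) \<Rightarrow> (real \<Rightarrow> 'a \<Rightarrow> real) \<Rightarrow> bool" where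
  "reflected_SDE M F W b \<sigma> l u x X L R \<longleftrightarrow>
     adapted F X \<and> continuous_process M X \<and>
     (\<forall>\<omega>\<in>space M. \<forall>t\<ge>0. X t \<omega> \<in> {l..u}) \<and>
     increasing_process M F L \<and> increasing_process M F R \<and>
     (AE \<omega> in M. \<forall>t\<ge>0.
        X t \<omega> = x + (LBINT s:{0..t}. b (X s \<omega>)) + \<sigma> * W t \<omega> + L t \<omega> - R t \<omega>) \<and>
     (AE \<omega> in M. (\<integral>\<^sup>+t\<in>{0..}. indicator {l<..} (X t \<omega>) \<partial>stieltjes L \<omega>) = 0) \<and>
     (AE \<omega> in M. (\<integral>\<^sup>+t\<in>{0..}. indicator {..<u} (X t \<omega>) \<partial>stieltjes R \<omega>) = 0)"

text \<open>Uniform convergence on compact time intervals in probability. The outer measure agrees with the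
  measure on measurable events; it is used because an almost surely continuous process over
  an incomplete space need not have measurable running suprema.\<close>

definition ucp_tendsto ::
  "'a measure \<Rightarrow> (nat \<Rightarrow> real \<Rightarrow> 'a \<Rightarrow> real) \<Rightarrow> (real \<Rightarrow> 'a \<Rightarrow> real) \<Rightarrow> bool" where
  "ucp_tendsto M Z Z' \<longleftrightarrow>
     (\<forall>t\<ge>0. \<forall>\<epsilon>>0.
        (\<lambda>n. outer_measure_of M {\<omega>\<in>space M. \<exists>s\<in>{0..t}. \<epsilon> < \<bar>Z n s \<omega> - Z' s \<omega>\<bar>}) \<longlonglongrightarrow> 0)"

text \<open>Simple predictable processes take the value \<open>z\<close> at time \<open>0\<close> and \<open>h i\<close> on \<open>(\<tau> i, \<tau> (i + 1)]\<close>, with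
  \<open>h i\<close> measurable at the stopping time \<open>\<tau> i\<close>. Integration is over \<open>(0, t]\<close>, hence no term \<open>z * Y 0\<close>
  in the elementary integral.\<close>

definition simple_predictable ::
  "'a measure \<Rightarrow> (real \<Rightarrow> 'a measure) \<Rightarrow> nat \<Rightarrow> (nat \<Rightarrow> 'a \<Rightarrow> real) \<Rightarrow> ('a \<Rightarrow> real) \<Rightarrow> (nat \<Rightarrow> 'a \<Rightarrow> real) \<Rightarrow> bool"
where
  "simple_predictable M F n \<tau> z h \<longleftrightarrow>
     (\<forall>i\<le>n. stopping_time F (\<tau> i)) \<and>
     (\<forall>\<omega>\<in>space M. \<tau> 0 \<omega> = 0 \<and> (\<forall>i<n. \<tau> i \<omega> \<le> \<tau> (Suc i) \<omega>)) \<and>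
     z \<in> borel_measurable (F 0) \<and>
     (\<forall>i<n. h i \<in> borel_measurable (filtration.pre_sigma (space M) F (\<tau> i)))"

definition simple_process ::
  "nat \<Rightarrow> (nat \<Rightarrow> 'a \<Rightarrow> real) \<Rightarrow> ('a \<Rightarrow> real) \<Rightarrow> (nat \<Rightarrow> 'a \<Rightarrow> real) \<Rightarrow> real \<Rightarrow> 'a \<Rightarrow> real" where
  "simple_process n \<tau> z h t \<omega> =
     z \<omega> * indicator {0} t + (\<Sum>i<n. h i \<omega> * indicator {\<tau> i \<omega> <.. \<tau> (Suc i) \<omega>} t)"

definition simple_integral ::
  "nat \<Rightarrow> (nat \<Rightarrow> 'a \<Rightarrow> real) \<Rightarrow> (nat \<Rightarrow> 'a \<Rightarrow> real) \<Rightarrow> (real \<Rightarrow> 'a \<Rightarrow> real) \<Rightarrow> real \<Rightarrow> 'a \<Rightarrow> real" where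
  "simple_integral n \<tau> h Y t \<omega> =
     (\<Sum>i<n. h i \<omega> * (Y (min t (\<tau> (Suc i) \<omega>)) \<omega> - Y (min t (\<tau> i \<omega>)) \<omega>))"

text \<open>\<open>N\<close> is a version of the Ito integral process \<open>N\<^sub>t = \<integral>\<^sub>0\<^sup>t H\<^sub>s dY\<^sub>s\<close> of a continuous adapted \<open>H\<close> against
  a continuous semimartingale \<open>Y\<close>: the value at \<open>H\<close> of the extension of the elementary
  integral that is continuous with respect to ucp convergence (Protter, \<^emph>\<open>Stochastic Integration and
  Differential Equations\<close>, Section II.4). Continuous adapted \<open>H\<close> are ucp limits of simple
  predictable processes, so \<open>N\<close> is unique up to indistinguishability.\<close>

definition is_stochastic_integral ::
  "'a measure \<Rightarrow> (real \<Rightarrow> 'a measure) \<Rightarrow> (real \<Rightarrow> 'a \<Rightarrow> real) \<Rightarrow> (real \<Rightarrow> 'a \<Rightarrow> real) \<Rightarrow> (real \<Rightarrow> 'a \<Rightarrow> real) \<Rightarrow> bool"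
where
  "is_stochastic_integral M F H Y N \<longleftrightarrow>
     adapted F N \<and> (AE \<omega> in M. continuous_on {0..} (\<lambda>t. N t \<omega>)) \<and>
     (\<forall>n \<tau> z h.
        (\<forall>k. simple_predictable M F (n k) (\<tau> k) (z k) (h k)) \<and>
        ucp_tendsto M (\<lambda>k. simple_process (n k) (\<tau> k) (z k) (h k)) H \<longrightarrow>
        ucp_tendsto M (\<lambda>k. simple_integral (n k) (\<tau> k) (h k) Y) N)"

text \<open>The least squares estimator, \<open>N\<close> being the process \<open>\<integral>\<^sub>0\<^sup>T f(X\<^sub>t) (dX\<^sub>t - dL\<^sub>t + dR\<^sub>t)\<close>.\<close>

definition lse ::
  "(real \<Rightarrow> real) \<Rightarrow> (real \<Rightarrow> 'a \<Rightarrow> real) \<Rightarrow> (real \<Rightarrow> 'a \<Rightarrow> real) \<Rightarrow> real \<Rightarrow> 'a \<Rightarrow> real" where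
  "lse f X N T \<omega> =
     (let D = (LBINT t:{0..T}. (f (X t \<omega>))\<^sup>2) in if D = 0 then 0 else N T \<omega> / D)"

definition tendsto_in_prob :: "'a measure \<Rightarrow> (real \<Rightarrow> 'a \<Rightarrow> real) \<Rightarrow> real \<Rightarrow> bool" where
  "tendsto_in_prob M Z c \<longleftrightarrow>
     (\<forall>\<epsilon>>0. ((\<lambda>T. measure M {\<omega>\<in>space M. \<epsilon> < \<bar>Z T \<omega> - c\<bar>}) \<longlongrightarrow> 0) at_top)"

end

theory Submission
  imports Defs
begin

text \<open>Write \<open>D\<^sub>T = \<integral>\<^sub>0\<^sup>T f\<^sup>2(X\<^sub>t) dt\<close>. The numerator of the estimator is
  \<open>\<theta>\<^sub>0 D\<^sub>T + \<sigma> \<integral>\<^sub>0\<^sup>T f(X\<^sub>t) dW\<^sub>t\<close>, and by the Ito isometry the second term is of order \<open>\<surd>T\<close> in probability,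
  so it suffices that \<open>D\<^sub>T\<close> grows at least linearly with probability tending to one.

  Choose an interval \<open>[a, b]\<close> inside \<open>(l, u)\<close> on which \<open>f\<close> is bounded away from zero. Given the past, with
  probability at least some fixed \<open>p > 0\<close>, over the window \<open>[k, k + 1]\<close> the Brownian motion first rises so much
  that \<open>X\<close> hits \<open>u\<close>, then falls so much that \<open>X\<close> hits \<open>l\<close>, and has a prescribed modulus of continuity. While
  \<open>X\<close> crosses \<open>[a, b]\<close> it is not reflected, so its speed is limited and \<open>D\<close> gains at least a fixed amount.
  A Chernoff bound shows that a positive fraction of the windows is of this kind.\<close>

section \<open>Brownian increments\<close>

text \<open>The probability of a good window given the past needs one lower bound that serves for
  every past. The good events are therefore stated through increments of \<open>W\<close> after time
  \<open>k\<close>, which are independent of \<open>F (real k)\<close>; that they force a slow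
  crossing is then a deterministic fact about paths, valid from every starting point in
  \<open>[l, u]\<close>. Large moves and smoothness of \<open>W\<close> are dependent, so smoothness
  is treated by subtraction: its failure is made less likely, given the past, than half the
  probability of the two large moves.

  The integral \<open>N\<close> is given only as a ucp limit of elementary integrals. The isometry
  is proved for grid sums, and only the resulting tail bound is carried to the limit: for fixed
  \<open>T\<close>, the numerator differs from its drift part by more than \<open>\<epsilon>\<close>
  with probability at most a constant times \<open>T / \<epsilon>\<^sup>2\<close>. The denominator
  being of order \<open>T\<close>, the relevant \<open>\<epsilon>\<close> is also of order
  \<open>T\<close>, which leaves a bound of order \<open>1 / T\<close>.\<close>

lemma (in prob_space) subalgebra_expectation_ge:
  assumes sub: "subalgebra M G" and A: "A \<in> events" and "0 \<le> p"
    and le: "\<And>B. B \<in> sets G \<Longrightarrow> p * prob B \<le> prob (A \<inter> B)"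
    and Z: "Z \<in> borel_measurable G" "\<And>\<omega>. \<omega> \<in> space M \<Longrightarrow> 0 \<le> Z \<omega>" "integrable M Z"
  shows "p * expectation Z \<le> expectation (\<lambda>\<omega>. Z \<omega> * indicator A \<omega>)"
proof -
  let ?D = "density M (indicator A)"
  have sub': "subalgebra ?D G" using sub by (simp add: subalgebra_def)
  note [measurable] = A measurable_from_subalg[OF sub Z(1)]
  have int: "integrable M (\<lambda>\<omega>. Z \<omega> * indicator A \<omega>)"
    using integrable_real_mult_indicator[OF A Z(3)] by simp
  \<comment> \<open>By \<open>le\<close>, on \<open>G\<close> the measure scaled by \<open>p\<close>
    is dominated by the measure with density \<open>indicator A\<close>. Integrals of nonnegative
    \<open>G\<close>-measurable functions are monotone in the measure, which carries the bound from
    sets to \<open>Z\<close>. This is the integrated form of a lower bound \<open>p\<close> on the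
    conditional probability of \<open>A\<close> given \<open>G\<close>.\<close>
  have "ennreal p * (\<integral>\<^sup>+\<omega>. Z \<omega> \<partial>M) = (\<integral>\<^sup>+\<omega>. Z \<omega> \<partial>scale_measure p (restr_to_subalg M G))"
    using Z(1) sub by (subst nn_integral_scale_measure)
      (auto simp: nn_integral_subalgebra2 measurable_restrict_space1 intro!: measurable_in_subalg)
  also have "\<dots> \<le> (\<integral>\<^sup>+\<omega>. Z \<omega> \<partial>restr_to_subalg ?D G)"
  proof (rule nn_integral_mono_measure)
    show sets: "sets (scale_measure p (restr_to_subalg M G)) = sets (restr_to_subalg ?D G)"
      using sub sub' by (simp add: sets_restr_to_subalg)
    have "ennreal p * emeasure M B \<le> emeasure ?D B" if B: "B \<in> sets G" for B
    proof -
      have [measurable]: "B \<in> sets M" using B sub by (auto simp: subalgebra_def)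
      have "emeasure ?D B = emeasure M (A \<inter> B)"
        by (simp add: emeasure_density flip: indicator_inter_arith)
      then show ?thesis
        using le[OF B] \<open>0 \<le> p\<close> by (simp add: emeasure_eq_measure flip: ennreal_mult)
    qed
    then show "scale_measure p (restr_to_subalg M G) \<le> restr_to_subalg ?D G"
      using sub sub' by (subst le_measure[OF sets])
        (auto simp: sets_restr_to_subalg emeasure_restr_to_subalg)
  qed
  also have "\<dots> = (\<integral>\<^sup>+\<omega>. Z \<omega> * indicator A \<omega> \<partial>M)"
    using Z(1) sub' by (subst nn_integral_subalgebra2)
      (auto simp: nn_integral_density ac_simps ennreal_indicator ennreal_mult'' intro!: nn_integral_cong)
  finally have "ennreal (p * expectation Z) \<le> ennreal (expectation (\<lambda>\<omega>. Z \<omega> * indicator A \<omega>))"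
    using Z int \<open>0 \<le> p\<close> by (simp add: nn_integral_eq_integral ennreal_mult Bochner_Integration.integral_nonneg)
  then show ?thesis
    using Z by (subst (asm) ennreal_le_iff) (auto intro!: Bochner_Integration.integral_nonneg)
qed

locale brownian =
  fixes M :: "'a measure" and F :: "real \<Rightarrow> 'a measure" and W :: "real \<Rightarrow> 'a \<Rightarrow> real"
  assumes filtered: "filtered_prob_space M F" and brownian: "brownian_motion M F W"

sublocale brownian \<subseteq> prob_space M
  using filtered by (simp add: filtered_prob_space_def)

section \<open>Independence and moments of increments, and the frequency of good windows\<close>

context brownian
begin

abbreviation inc :: "real \<Rightarrow> real \<Rightarrow> 'a \<Rightarrow> real" where
  "inc s t \<omega> \<equiv> W t \<omega> - W s \<omega>"

lemma subalgebra_F: "subalgebra M (F t)"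
  using filtered by (simp add: filtered_prob_space_def)

lemma space_F [simp]: "space (F t) = space M"
  using subalgebra_F by (simp add: subalgebra_def)

lemma sets_F_mono: "s \<le> t \<Longrightarrow> sets (F s) \<subseteq> sets (F t)"
  using filtered by (auto simp: filtered_prob_space_def filtration_def)

lemma sets_F: "A \<in> sets (F t) \<Longrightarrow> A \<in> events"
  using subalgebra_F by (auto simp: subalgebra_def)

lemma measurable_F: "g \<in> measurable (F t) N \<Longrightarrow> g \<in> measurable M N"
  using measurable_from_subalg[OF subalgebra_F] .

lemma measurable_F_mono: "s \<le> t \<Longrightarrow> g \<in> measurable (F s) N \<Longrightarrow> g \<in> measurable (F t) N"
  using sets_F_mono[of s t] by (auto simp: measurable_def)

lemma W_F: "0 \<le> s \<Longrightarrow> s \<le> t \<Longrightarrow> W s \<in> borel_measurable (F t)"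
  using brownian measurable_F_mono[of s t "W s" borel] by (auto simp: brownian_motion_def adapted_def)

lemma W_measurable [measurable]: "0 \<le> s \<Longrightarrow> W s \<in> borel_measurable M"
  using W_F[of s s] measurable_F by blast

lemma W_continuous: "\<omega> \<in> space M \<Longrightarrow> continuous_on {0..} (\<lambda>t. W t \<omega>)"
  using brownian by (auto simp: brownian_motion_def continuous_process_def)

lemma distributed_inc:
  "0 \<le> s \<Longrightarrow> s < t \<Longrightarrow> distributed M lborel (inc s t) (normal_density 0 (sqrt (t - s)))"
  using brownian by (auto simp: brownian_motion_def)

lemma indep_inc:
  "0 \<le> s \<Longrightarrow> s < t \<Longrightarrow> indep_set (sets (F s)) (sets (vimage_algebra (space M) (inc s t) borel))"
  using brownian by (auto simp: brownian_motion_def)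

lemma prob_inter_inc:
  assumes "0 \<le> s" "s < t" "B \<in> sets (F s)" "S \<in> sets borel"
  shows "prob (B \<inter> {\<omega> \<in> space M. inc s t \<omega> \<in> S}) = prob B * prob {\<omega> \<in> space M. inc s t \<omega> \<in> S}"
proof -
  have "{\<omega> \<in> space M. inc s t \<omega> \<in> S} \<in> sets (vimage_algebra (space M) (inc s t) borel)"
    using assms(4) by (auto simp: sets_vimage_algebra2)
  then show ?thesis using indep_setD[OF indep_inc] assms by blast
qed

lemma indep_var_inc:
  assumes st: "0 \<le> s" "s < t" and U: "U \<in> borel_measurable (F s)"
  shows "indep_var borel U borel (inc s t)"
  unfolding indep_var_eq
proof (intro conjI)
  show "random_variable borel U" using U measurable_F by blast
  show "random_variable borel (inc s t)" using st by (intro borel_measurable_diff W_measurable) auto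
  have "{U -` A \<inter> space M |A. A \<in> sets borel} \<subseteq> sets (F s)"
    using measurable_sets[OF U] by auto
  then have "sigma_sets (space M) {U -` A \<inter> space M |A. A \<in> sets borel} \<subseteq> sets (F s)"
    using sets.sigma_sets_subset[of _ "F s"] by simp
  moreover have "indep_sets (case_bool (sets (F s))
      (sigma_sets (space M) {inc s t -` A \<inter> space M |A. A \<in> sets borel})) UNIV"
    using indep_inc[OF st] unfolding indep_set_def sets_vimage_algebra .
  ultimately show "indep_set (sigma_sets (space M) {U -` A \<inter> space M |A. A \<in> sets borel})
     (sigma_sets (space M) {inc s t -` A \<inter> space M |A. A \<in> sets borel})"
    unfolding indep_set_def
    by (elim indep_sets_mono_sets) (auto split: bool.split)
qed

lemma
  assumes "0 \<le> s" "s < t"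
  shows integrable_inc_power: "integrable M (\<lambda>\<omega>. inc s t \<omega> ^ k)"
    and expectation_inc: "expectation (inc s t) = 0"
    and expectation_inc_square: "expectation (\<lambda>\<omega>. (inc s t \<omega>)\<^sup>2) = t - s"
    and expectation_inc_fourth: "expectation (\<lambda>\<omega>. inc s t \<omega> ^ 4) = 3 * (t - s)\<^sup>2"
proof -
  note D = distributed_inc[OF assms]
  have pos: "0 < sqrt (t - s)" using assms by simp
  show "integrable M (\<lambda>\<omega>. inc s t \<omega> ^ k)"
    using distributed_integrable[OF D, of "\<lambda>x. x ^ k"] integrable_normal_moment[OF pos, of 0 k] by simp
  show "expectation (inc s t) = 0"
    by (rule normal_distributed_expectation[OF pos D])
  show "expectation (\<lambda>\<omega>. (inc s t \<omega>)\<^sup>2) = t - s"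
    using normal_distributed_variance[OF pos D] normal_distributed_expectation[OF pos D] assms by simp
  have "(\<integral>x. normal_density 0 (sqrt (t - s)) x * x ^ 4 \<partial>lborel) = 3 * (t - s)\<^sup>2"
    using integral_normal_moment_even[OF pos, of 0 2] assms
    by (simp add: fact_numeral power_divide field_simps)
  then show "expectation (\<lambda>\<omega>. inc s t \<omega> ^ 4) = 3 * (t - s)\<^sup>2"
    using distributed_integral[OF D, of "\<lambda>x. x ^ 4"] by simp
qed

text \<open>Markov's inequality for the fourth power. The second moment would give a bound linear in
  \<open>t - s\<close>, and summed over the \<open>2 ^ j\<close> cells of length
  \<open>1 / 2 ^ j\<close> this would not decay in \<open>j\<close>.\<close>

lemma prob_inc_gt_le:
  assumes "0 \<le> s" "s < t" "0 < \<delta>"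
  shows "prob {\<omega> \<in> space M. inc s t \<omega> \<in> {x. \<delta> < \<bar>x\<bar>}} \<le> 3 * (t - s)\<^sup>2 / \<delta> ^ 4"
proof -
  have [measurable]: "inc s t \<in> borel_measurable M"
    using assms by (intro borel_measurable_diff W_measurable) auto
  have "prob {\<omega> \<in> space M. inc s t \<omega> \<in> {x. \<delta> < \<bar>x\<bar>}} \<le> prob {\<omega> \<in> space M. \<delta> ^ 4 \<le> inc s t \<omega> ^ 4}"
  proof (rule finite_measure_mono)
    have "\<delta> ^ 4 \<le> x ^ 4" if "\<delta> < \<bar>x\<bar>" for x
      using power_mono[of \<delta> "\<bar>x\<bar>" 4] that assms by simp
    then show "{\<omega> \<in> space M. inc s t \<omega> \<in> {x. \<delta> < \<bar>x\<bar>}} \<subseteq> {\<omega> \<in> space M. \<delta> ^ 4 \<le> inc s t \<omega> ^ 4}"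
      by auto
  qed measurable
  also have "\<dots> \<le> expectation (\<lambda>\<omega>. inc s t \<omega> ^ 4) / \<delta> ^ 4"
    using assms by (intro integral_Markov_inequality_measure[where A="space M"] integrable_inc_power) auto
  finally show ?thesis using expectation_inc_fourth[OF assms(1,2)] by simp
qed

text \<open>The law of an increment depends only on its length, so one \<open>q\<close> serves all
  starting times; it is positive because the normal density vanishes nowhere.\<close>

lemma prob_inc_pos:
  assumes "0 < h" "S \<in> sets borel" "emeasure lborel S \<noteq> 0"
  obtains q where "0 < q" "\<And>s. 0 \<le> s \<Longrightarrow> prob {\<omega> \<in> space M. inc s (s + h) \<omega> \<in> S} = q"
proof
  let ?N = "density lborel (normal_density 0 (sqrt h))"
  interpret N: prob_space ?N using assms(1) by (intro prob_space_normal_density) simp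
  show "prob {\<omega> \<in> space M. inc s (s + h) \<omega> \<in> S} = measure ?N S" if "0 \<le> s" for s
  proof -
    have D: "distributed M lborel (inc s (s + h)) (normal_density 0 (sqrt h))"
      using distributed_inc[of s "s + h"] that assms by simp
    show ?thesis
      using assms(2) measure_distr[OF distributed_measurable[OF D], of S] distributed_distr_eq_density[OF D]
      by (simp add: vimage_def Int_def conj_commute)
  qed
  have "emeasure ?N S \<noteq> 0"
  proof
    assume "emeasure ?N S = 0"
    then have "AE x in lborel. ennreal (normal_density 0 (sqrt h) x) * indicator S x = 0"
      using assms(2) by (simp add: emeasure_density nn_integral_0_iff_AE)
    then have "AE x in lborel. x \<notin> S"
    proof eventually_elim
      case (elim x)
      then show ?case
        using normal_density_pos[of "sqrt h" 0 x] assms(1)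
        by (auto simp: indicator_def ennreal_eq_0_iff split: if_splits)
    qed
    then show False using assms(2,3) by (simp add: AE_iff_measurable[OF _ refl])
  qed
  then show "0 < measure ?N S"
    by (simp add: N.emeasure_eq_measure zero_less_measure_iff)
qed

text \<open>The base balances two requirements: \<open>9/10 < 1\<close> makes the dyadic oscillations summable,
  and \<open>2 * (9/10) ^ 4 > 1\<close> makes the fourth moment bounds on the exceptional events summable.
  In the swing event \<open>k + 1\<close> is written \<open>k + 1/2 + 1/2\<close>, so that both halves have the form
  \<open>inc s (s + 1/2)\<close>.\<close>

definition smooth_event :: "nat \<Rightarrow> nat \<Rightarrow> 'a set" where
  "smooth_event m k = {\<omega> \<in> space M. \<forall>j\<ge>m. \<forall>i<2 ^ j.
     \<bar>inc (real k + real i / 2 ^ j) (real k + real (Suc i) / 2 ^ j) \<omega>\<bar> \<le> (9/10) ^ j}"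

definition swing_event :: "real \<Rightarrow> nat \<Rightarrow> nat \<Rightarrow> 'a set" where
  "swing_event K m k = smooth_event m k \<inter>
     {\<omega> \<in> space M. inc (real k) (real k + 1/2) \<omega> \<in> {K<..}} \<inter>
     {\<omega> \<in> space M. inc (real k + 1/2) (real k + 1/2 + 1/2) \<omega> \<in> {..<-K}}"

lemma dyadic_le: "i < 2 ^ j \<Longrightarrow> real (Suc i) / 2 ^ j \<le> 1"
  by (simp add: divide_le_eq) (metis Suc_leI of_nat_Suc of_nat_le_iff of_nat_numeral of_nat_power)

lemma smooth_event_F: "real k + 1 \<le> t \<Longrightarrow> smooth_event m k \<in> sets (F t)"
proof -
  assume t: "real k + 1 \<le> t"
  let ?d = "\<lambda>j i. inc (real k + real i / 2 ^ j) (real k + real (Suc i) / 2 ^ j)"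
  have "?d j i \<in> borel_measurable (F t)" if "i < 2 ^ j" for i j
  proof -
    have "real i / 2 ^ j \<le> real (Suc i) / 2 ^ j" by (intro divide_right_mono) auto
    moreover have "0 \<le> real i / 2 ^ j" by simp
    ultimately show ?thesis
      using dyadic_le[OF that] t by (intro borel_measurable_diff W_F) linarith+
  qed
  then have "Measurable.pred (F t) (\<lambda>\<omega>. \<bar>?d j i \<omega>\<bar> \<le> (9/10) ^ j)" if "i < 2 ^ j" for i j
    using that unfolding pred_def by (intro borel_measurable_le borel_measurable_abs borel_measurable_const) blast
  then have "Measurable.pred (F t) (\<lambda>\<omega>. \<forall>j. m \<le> j \<longrightarrow> (\<forall>i. i < 2 ^ j \<longrightarrow> \<bar>?d j i \<omega>\<bar> \<le> (9/10) ^ j))"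
    by (intro pred_intros_imp' pred_intros_countable(1)) blast
  then show ?thesis
    by (simp only: smooth_event_def pred_def space_F)
qed

text \<open>All increments involved end by time \<open>k + 1\<close>. Earlier windows thus belong to
  the past of a later one, which is what \<open>count_tendsto\<close> asks of its events.\<close>

lemma swing_event_F: "real k + 1 \<le> t \<Longrightarrow> swing_event K m k \<in> sets (F t)"
proof -
  assume t: "real k + 1 \<le> t"
  have [measurable]: "W (real k) \<in> borel_measurable (F t)" "W (real k + 1/2) \<in> borel_measurable (F t)"
    "W (real k + 1/2 + 1/2) \<in> borel_measurable (F t)"
    using t by (auto intro!: W_F)
  have "{\<omega> \<in> space (F t). inc (real k) (real k + 1/2) \<omega> \<in> {K<..}} \<in> sets (F t)"
    "{\<omega> \<in> space (F t). inc (real k + 1/2) (real k + 1/2 + 1/2) \<omega> \<in> {..<-K}} \<in> sets (F t)"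
    by measurable
  then show ?thesis
    using smooth_event_F[OF t] by (auto simp: swing_event_def)
qed

lemma swing_event_events [measurable]: "swing_event K m k \<in> events"
  using swing_event_F[of k "real k + 1"] sets_F by blast

text \<open>Union bound over all cells of all levels \<open>j \<ge> m\<close>. Every cell starts at
  or after time \<open>k\<close>, so its increment is independent of \<open>B\<close> and the factor
  \<open>prob B\<close> survives. The bound is thus uniform in the past, and it is the tail of a
  convergent geometric series.\<close>

lemma prob_not_smooth_le:
  assumes B: "B \<in> sets (F (real k))"
  shows "prob (B - smooth_event m k) \<le> 3 * (\<Sum>j. (5000/6561) ^ (j + m)) * prob B"
proof -
  let ?I = "\<lambda>j i. {\<omega> \<in> space M. inc (real k + real i / 2 ^ j) (real k + real (Suc i) / 2 ^ j) \<omega> \<in> {x. (9/10) ^ j < \<bar>x\<bar>}}"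
  have [measurable]: "?I j i \<in> events" for i j
    by measurable
  have [measurable]: "B \<in> events" using B sets_F by blast
  have incl: "B - smooth_event m k \<subseteq> (\<Union>j. \<Union>i<2 ^ (j + m). B \<inter> ?I (j + m) i)"
  proof
    fix \<omega> assume \<omega>: "\<omega> \<in> B - smooth_event m k"
    then have "\<omega> \<in> space M" using B sets.sets_into_space[OF \<open>B \<in> events\<close>] by auto
    with \<omega> obtain j i where "j \<ge> m" "i < 2 ^ j" "\<omega> \<in> B \<inter> ?I j i"
      by (auto simp: smooth_event_def not_le)
    then show "\<omega> \<in> (\<Union>j. \<Union>i<2 ^ (j + m). B \<inter> ?I (j + m) i)"
      by (intro UN_I[of "j - m"] UN_I[of i]) auto
  qed
  have one: "prob (B \<inter> ?I j i) \<le> prob B * (3 * (1 / 4 ^ j) / ((9/10) ^ 4) ^ j)" for i j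
  proof -
    let ?s = "real k + real i / 2 ^ j" and ?t = "real k + real (Suc i) / 2 ^ j"
    have st: "0 \<le> ?s" "?s < ?t" by (auto simp: divide_strict_right_mono)
    have "B \<in> sets (F ?s)" using B sets_F_mono[of "real k" ?s] by auto
    then have "prob (B \<inter> ?I j i) = prob B * prob (?I j i)"
      using st by (intro prob_inter_inc) auto
    also have "\<dots> \<le> prob B * (3 * (?t - ?s)\<^sup>2 / ((9/10) ^ j) ^ 4)"
      using st by (intro mult_left_mono prob_inc_gt_le) auto
    also have "?t - ?s = 1 / 2 ^ j" by (simp add: field_simps)
    also have "(1 / 2 ^ j :: real)\<^sup>2 = 1 / 4 ^ j" 
      by (simp add: power_divide flip: power_mult) (simp add: power_mult mult.commute[of j])
    also have "((9/10) ^ j :: real) ^ 4 = ((9/10) ^ 4) ^ j" by (simp add: mult.commute flip: power_mult)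
    finally show ?thesis .
  qed
  have level: "prob (\<Union>i<2 ^ j. B \<inter> ?I j i) \<le> 3 * (5000/6561) ^ j * prob B" for j
  proof -
    have "prob (\<Union>i<2 ^ j. B \<inter> ?I j i) \<le> (\<Sum>i<2 ^ j. prob (B \<inter> ?I j i))"
      by (intro finite_measure_subadditive_finite) auto
    also have "\<dots> \<le> (\<Sum>i<(2::nat) ^ j. prob B * (3 * (1 / 4 ^ j) / ((9/10) ^ 4) ^ j))"
      by (intro sum_mono one)
    also have "\<dots> = 3 * (2 ^ j * (1 / 4 ^ j) / ((9/10) ^ 4) ^ j) * prob B"
      by simp
    also have "2 ^ j * (1 / 4 ^ j) / y ^ j = (2 * (1 / 4) / y) ^ j" for y :: real
      by (simp only: power_divide power_mult_distrib power_one)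
    \<comment> \<open>Ratio between successive levels: twice as many cells, a squared length smaller
      by the factor 4, and a threshold whose fourth power shrinks by
      \<open>(9/10) ^ 4\<close>.\<close>
    also have "(2 * (1 / 4) / (9/10) ^ 4 :: real) = 5000/6561" by (simp add: power_divide)
    finally show ?thesis .
  qed
  have summ: "summable (\<lambda>j. (5000/6561 :: real) ^ (j + m))"
    using summable_ignore_initial_segment[OF summable_geometric] by auto
  have summ2: "summable (\<lambda>j. 3 * (5000/6561 :: real) ^ (j + m) * prob B)"
    using summ by (intro summable_mult summable_mult2)
  have "prob (B - smooth_event m k) \<le> prob (\<Union>j. \<Union>i<2 ^ (j + m). B \<inter> ?I (j + m) i)"
    by (rule finite_measure_mono[OF incl]) measurable
  also have "\<dots> \<le> (\<Sum>j. prob (\<Union>i<2 ^ (j + m). B \<inter> ?I (j + m) i))"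
    using level by (intro finite_measure_subadditive_countably summable_comparison_test'[OF summ2]) auto
  also have "\<dots> \<le> (\<Sum>j. 3 * (5000/6561) ^ (j + m) * prob B)"
    using level by (intro suminf_le summable_comparison_test'[OF summ2, of 0]  summ2) auto
  also have "\<dots> = 3 * (\<Sum>j. (5000/6561) ^ (j + m)) * prob B"
    using suminf_mult2[OF summable_mult[OF summ, of 3], of "prob B"] suminf_mult[OF summ, of 3] by simp
  finally show ?thesis .
qed

text \<open>The two large moves have probability \<open>q1 * q2\<close> given the past, and for
  large \<open>m\<close> the failure of smoothness takes away at most half of it. Since
  \<open>p\<close> is fixed before \<open>m\<close>, the level \<open>m\<close> can later be raised
  to meet further conditions.\<close>

lemma swing_event_prob_ge:
  obtains p where "0 < p"
    "\<forall>\<^sub>F m in sequentially. \<forall>k. \<forall>B\<in>sets (F (real k)). p * prob B \<le> prob (swing_event K m k \<inter> B)"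
proof -
  have pos: "emeasure lborel {K<..} \<noteq> 0" "emeasure lborel {..<-K} \<noteq> 0"
  proof -
    have "emeasure lborel {K<..K+1} \<le> emeasure lborel {K<..}"
      "emeasure lborel {-K-2..-K-1} \<le> emeasure lborel {..<-K}"
      by (intro emeasure_mono; auto)+
    then show "emeasure lborel {K<..} \<noteq> 0" "emeasure lborel {..<-K} \<noteq> 0"
      by auto
  qed
  obtain q1 where q1: "0 < q1" "\<And>s. 0 \<le> s \<Longrightarrow> prob {\<omega> \<in> space M. inc s (s + 1/2) \<omega> \<in> {K<..}} = q1"
    using prob_inc_pos[OF _ _ pos(1), of "1/2"] by auto
  obtain q2 where q2: "0 < q2" "\<And>s. 0 \<le> s \<Longrightarrow> prob {\<omega> \<in> space M. inc s (s + 1/2) \<omega> \<in> {..<-K}} = q2"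
    using prob_inc_pos[OF _ _ pos(2), of "1/2"] by auto
  have lim: "(\<lambda>m. 3 * (\<Sum>j. (5000/6561 :: real) ^ (j + m))) \<longlonglongrightarrow> 3 * 0"
    by (intro tendsto_mult tendsto_const suminf_exist_split2 summable_geometric) auto
  have ev: "\<forall>\<^sub>F m in sequentially. 3 * (\<Sum>j. (5000/6561 :: real) ^ (j + m)) < q1 * q2 / 2"
    using q1(1) q2(1) by (intro order_tendstoD(2)[OF lim]) auto
  show ?thesis
  proof
    show "0 < q1 * q2 / 2" using q1 q2 by simp
    show "\<forall>\<^sub>F m in sequentially. \<forall>k. \<forall>B\<in>sets (F (real k)).
        q1 * q2 / 2 * prob B \<le> prob (swing_event K m k \<inter> B)"
      using ev
    proof (eventually_elim, intro allI ballI)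
      fix m k B
      assume small: "3 * (\<Sum>j. (5000/6561 :: real) ^ (j + m)) < q1 * q2 / 2" and B: "B \<in> sets (F (real k))"
      let ?A1 = "{\<omega> \<in> space M. inc (real k) (real k + 1/2) \<omega> \<in> {K<..}}"
        and ?A2 = "{\<omega> \<in> space M. inc (real k + 1/2) (real k + 1/2 + 1/2) \<omega> \<in> {..<-K}}"
      have [measurable]: "W (real k) \<in> borel_measurable (F (real k + 1/2))"
         "W (real k + 1/2) \<in> borel_measurable (F (real k + 1/2))"
        by (auto intro!: W_F)
      have "?A1 \<in> sets (F (real k + 1/2))"
        unfolding space_F[of "real k + 1/2", symmetric] by measurable
      \<comment> \<open>The past together with the rise is known at time \<open>k + 1/2\<close>,
        hence independent of the fall.\<close>
      then have BA1: "B \<inter> ?A1 \<in> sets (F (real k + 1/2))"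
        using B sets_F_mono[of "real k" "real k + 1/2"] by auto
      have S: "smooth_event m k \<in> events"
        using smooth_event_F[OF order_refl] sets_F by blast
      have [measurable]: "B \<in> events" using B sets_F by blast
      have [measurable]: "?A1 \<in> events" "?A2 \<in> events" by measurable
      have "prob (B \<inter> ?A1 \<inter> ?A2) = prob (B \<inter> ?A1) * q2"
        using prob_inter_inc[OF _ _ BA1, of "real k + 1/2 + 1/2" "{..<-K}"] q2(2)[of "real k + 1/2"] by simp
      also have "prob (B \<inter> ?A1) = prob B * q1"
        using prob_inter_inc[OF _ _ B, of "real k + 1/2" "{K<..}"] q1(2)[of "real k"] by simp
      finally have "prob B * q1 * q2 = prob (B \<inter> ?A1 \<inter> ?A2)" by simp
      also have "\<dots> \<le> prob ((swing_event K m k \<inter> B) \<union> (B - smooth_event m k))"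
        using S by (intro finite_measure_mono) (auto simp: swing_event_def)
      also have "\<dots> \<le> prob (swing_event K m k \<inter> B) + prob (B - smooth_event m k)"
        using S by (intro measure_Un_le) auto
      also have "prob (B - smooth_event m k) \<le> q1 * q2 / 2 * prob B"
        using prob_not_smooth_le[OF B, of m] small
        by (meson less_imp_le measure_nonneg mult_right_mono order_trans)
      finally show "q1 * q2 / 2 * prob B \<le> prob (swing_event K m k \<inter> B)" by (simp add: mult_ac)
    qed
  qed
qed

text \<open>Chernoff's method, with the weight \<open>(1/2) ^ count\<close>.\<close>

lemma count_tendsto:
  assumes p: "0 < p"
    and A: "\<And>k. A k \<in> sets (F (real k + 1))"
    and le: "\<And>k B. B \<in> sets (F (real k)) \<Longrightarrow> p * prob B \<le> prob (A k \<inter> B)"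
  obtains \<gamma> where "0 < \<gamma>"
    "(\<lambda>n. prob {\<omega> \<in> space M. (\<Sum>k<n. indicator (A k) \<omega>) \<le> \<gamma> * real n}) \<longlonglongrightarrow> 0"
proof -
  \<comment> \<open>Bound on the conditional mean of one factor
    \<open>1 - indicator (A k) / 2\<close>, the event having conditional probability at least
    \<open>p\<close>.\<close>
  define r where "r = 1 - p / 2"
  have "p \<le> 1" using le[of "space M" 0] sets.top[of "F 0"]
    by (simp add: prob_space) (meson order_trans prob_le_1)
  with p have r: "0 < r" "r < 1" by (auto simp: r_def)
  define Z where "Z n \<omega> = (\<Prod>k<n. 1 - indicator (A k) \<omega> / 2 :: real)" for n \<omega>
  have ZF: "Z n \<in> borel_measurable (F (real n))" for n
  proof -
    have "(\<lambda>\<omega>. indicator (A k) \<omega> :: real) \<in> borel_measurable (F (real n))" if "k < n" for k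
      using A[of k] sets_F_mono[of "real k + 1" "real n"] that by (intro borel_measurable_indicator) auto
    then show ?thesis unfolding Z_def by measurable
  qed
  have Zm[measurable]: "Z n \<in> borel_measurable M" for n using ZF measurable_F by blast
  have Z01: "0 \<le> Z n \<omega>" "Z n \<omega> \<le> 1" for n \<omega>
    unfolding Z_def by (auto intro!: prod_nonneg prod_le_1 simp: indicator_def)
  have Zint: "integrable M (Z n)" for n
    using Z01 by (intro integrable_const_bound[of _ 1]) auto
  have EZ: "expectation (Z n) \<le> r ^ n" for n
  proof (induction n)
    case 0
    then show ?case by (simp add: Z_def prob_space)
  next
    case (Suc n)
    have An: "A n \<in> events" using A sets_F by blast
    have int: "integrable M (\<lambda>\<omega>. Z n \<omega> * indicator (A n) \<omega>)"
      using integrable_real_mult_indicator[OF An Zint] .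
    have "p * expectation (Z n) \<le> expectation (\<lambda>\<omega>. Z n \<omega> * indicator (A n) \<omega>)"
      using p le Z01 ZF Zint An by (intro subalgebra_expectation_ge[OF subalgebra_F]) auto
    moreover have "Z (Suc n) = (\<lambda>\<omega>. Z n \<omega> - Z n \<omega> * indicator (A n) \<omega> / 2)"
      by (auto simp: Z_def algebra_simps fun_eq_iff)
    ultimately have "expectation (Z (Suc n)) \<le> r * expectation (Z n)"
      using Zint int by (simp add: r_def algebra_simps)
    also have "\<dots> \<le> r * r ^ n" using Suc r by simp
    finally show ?case by simp
  qed
  \<comment> \<open>Chosen so that \<open>(1/2) powr (\<gamma> * n)\<close> equals
    \<open>sqrt r ^ n\<close>: a mean of at most \<open>r ^ n\<close> divided by this threshold
    still leaves the decaying bound \<open>sqrt r ^ n\<close>.\<close>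
  define \<gamma> where "\<gamma> = ln r / (2 * ln (1/2))"
  have \<gamma>: "0 < \<gamma>" using r unfolding \<gamma>_def by (intro divide_neg_neg mult_pos_neg) auto
  have half: "(1/2) powr (\<gamma> * real n) = sqrt r ^ n" for n
  proof -
    have "(1/2) powr (\<gamma> * real n) = r powr (real n / 2)"
      using r by (simp add: powr_def \<gamma>_def ln_div)
    also have "\<dots> = (r powr (1/2)) powr real n" by (simp add: powr_powr)
    finally show ?thesis using r by (simp add: powr_half_sqrt powr_realpow)
  qed
  have bound: "prob {\<omega> \<in> space M. (\<Sum>k<n. indicator (A k) \<omega>) \<le> \<gamma> * real n} \<le> sqrt r ^ n" for n
  proof -
    have "prob {\<omega> \<in> space M. (\<Sum>k<n. indicator (A k) \<omega>) \<le> \<gamma> * real n}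
        \<le> prob {\<omega> \<in> space M. sqrt r ^ n \<le> Z n \<omega>}"
    proof (rule finite_measure_mono)
      have "Z n \<omega> = (1/2) powr (\<Sum>k<n. indicator (A k) \<omega>)" for \<omega>
        unfolding Z_def by (subst powr_sum) (auto intro!: prod.cong simp: indicator_def)
      then show "{\<omega> \<in> space M. (\<Sum>k<n. indicator (A k) \<omega>) \<le> \<gamma> * real n}
          \<subseteq> {\<omega> \<in> space M. sqrt r ^ n \<le> Z n \<omega>}"
        unfolding half[symmetric] by (auto intro!: powr_mono')
    qed measurable
    also have "\<dots> \<le> expectation (Z n) / sqrt r ^ n"
      using r Z01 by (intro integral_Markov_inequality_measure[where A="space M"] Zint) auto
    also have "\<dots> \<le> r ^ n / sqrt r ^ n"
      using r by (intro divide_right_mono EZ) auto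
    also have "\<dots> = sqrt r ^ n"
      using r by (simp add: real_div_sqrt flip: power_divide)
    finally show ?thesis .
  qed
  have "(\<lambda>n. prob {\<omega> \<in> space M. (\<Sum>k<n. indicator (A k) \<omega>) \<le> \<gamma> * real n}) \<longlonglongrightarrow> 0"
  proof (rule tendsto_sandwich[OF _ _ tendsto_const])
    show "(\<lambda>n. sqrt r ^ n) \<longlonglongrightarrow> 0" using r by (intro LIMSEQ_power_zero) auto
  qed (use bound in auto)
  with \<gamma> that show ?thesis by blast
qed

end

section \<open>Reflected paths\<close>

text \<open>Chaining: \<open>s\<close> is the limit of its dyadic approximations from below, and
  each refinement moves by at most one cell of the new level. The levels above \<open>m\<close>
  contribute the sum of \<open>(9/10) ^ j\<close> over \<open>j > m\<close>, which is
  \<open>9 * (9/10) ^ m\<close>; continuity gives the limit.\<close>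

lemma dyadic_modulus_dist:
  fixes g :: "real \<Rightarrow> real"
  assumes cont: "continuous_on {0..1} g"
    and step: "\<And>j i. m \<le> j \<Longrightarrow> i < 2 ^ j \<Longrightarrow> \<bar>g (real (Suc i) / 2 ^ j) - g (real i / 2 ^ j)\<bar> \<le> (9/10) ^ j"
    and s: "s \<in> {0..1}"
  shows "\<bar>g s - g (real (nat \<lfloor>s * 2 ^ m\<rfloor>) / 2 ^ m)\<bar> \<le> 9 * (9/10) ^ m"
proof -
  define n where "n j = nat \<lfloor>s * 2 ^ j\<rfloor>" for j
  define d where "d j = real (n j) / 2 ^ j" for j
  have n: "real (n j) \<le> s * 2 ^ j" "s * 2 ^ j < real (n j) + 1" for j
    using s by (auto simp: of_nat_nat n_def)
  have d_le: "d j \<le> s" and d_nonneg: "0 \<le> d j" for j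
    using n[of j] by (auto simp: d_def divide_le_eq)
  have d_ge: "s - 1 / 2 ^ j \<le> d j" for j
  proof -
    have "s \<le> (real (n j) + 1) / 2 ^ j" using n(2)[of j] by (simp add: le_divide_eq)
    then show ?thesis by (simp add: d_def add_divide_distrib)
  qed
  have d_step: "\<bar>g (d (Suc j)) - g (d j)\<bar> \<le> (9/10) ^ Suc j" if "m \<le> j" for j
  proof -
    have "real (2 * n j) < real (n (Suc j) + 1)" "real (n (Suc j)) < real (2 * n j + 2)"
      using n[of j] n[of "Suc j"] by simp_all
    then have "n (Suc j) = 2 * n j \<or> n (Suc j) = Suc (2 * n j)"
      by (simp only: of_nat_less_iff) linarith
    moreover have dj: "d j = real (2 * n j) / 2 ^ Suc j" "d (Suc j) = real (n (Suc j)) / 2 ^ Suc j"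
      by (simp_all add: d_def)
    \<comment> \<open>In the case \<open>n (Suc j) = Suc (2 * n j)\<close> this puts the traversed
      cell inside \<open>[0, 1]\<close>, where \<open>step\<close> applies.\<close>
    moreover have "n (Suc j) \<le> 2 ^ Suc j"
    proof -
      have "real (n (Suc j)) \<le> 1 * 2 ^ Suc j"
        using s by (intro order_trans[OF n(1)] mult_right_mono) auto
      also have "\<dots> = real (2 ^ Suc j)" by simp
      finally show ?thesis by (simp only: of_nat_le_iff)
    qed
    ultimately show ?thesis
      using step[of "Suc j" "2 * n j"] that by (auto simp del: power_Suc of_nat_Suc)
  qed
  \<comment> \<open>The bound is the exact partial geometric sum; subtracting the remainder is what
    lets the induction close.\<close>
  have tele: "\<bar>g (d (m + i)) - g (d m)\<bar> \<le> 9 * (9/10) ^ m - 9 * (9/10) ^ (m + i)" for i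
  proof (induction i)
    case (Suc i)
    then show ?case using d_step[of "m + i"] unfolding add_Suc_right power_Suc by linarith
  qed simp
  have "(\<lambda>n. d (m + n)) \<longlonglongrightarrow> s"
  proof (rule tendsto_sandwich)
    have "(\<lambda>n. s - (1/2) ^ (n + m)) \<longlonglongrightarrow> s - 0"
      by (intro tendsto_intros LIMSEQ_ignore_initial_segment LIMSEQ_power_zero) auto
    then show "(\<lambda>n. s - 1 / 2 ^ (m + n)) \<longlonglongrightarrow> s"
      by (simp add: power_divide add.commute)
  qed (use d_le d_ge in auto)
  then have "(\<lambda>n. g (d (m + n))) \<longlonglongrightarrow> g s"
    using s d_le d_nonneg by (intro continuous_on_tendsto_compose[OF cont])
      (auto intro!: always_eventually intro: order_trans)
  then have "(\<lambda>n. \<bar>g (d (m + n)) - g (d m)\<bar>) \<longlonglongrightarrow> \<bar>g s - g (d m)\<bar>"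
    by (intro tendsto_intros)
  moreover have "\<bar>g (d (m + n)) - g (d m)\<bar> \<le> 9 * (9/10) ^ m" for n
    by (rule order_trans[OF tele]) simp
  ultimately show ?thesis
    unfolding d_def n_def by (intro LIMSEQ_le_const2) auto
qed

text \<open>The level \<open>m\<close> approximations of \<open>s\<close> and \<open>t\<close> are
  at most one cell apart, so 19 is two chaining tails of 9 and one step of 1.\<close>

lemma dyadic_modulus:
  fixes g :: "real \<Rightarrow> real"
  assumes cont: "continuous_on {0..1} g"
    and step: "\<And>j i. m \<le> j \<Longrightarrow> i < 2 ^ j \<Longrightarrow> \<bar>g (real (Suc i) / 2 ^ j) - g (real i / 2 ^ j)\<bar> \<le> (9/10) ^ j"
    and st: "0 \<le> s" "s \<le> t" "t \<le> 1" "t - s \<le> 1 / 2 ^ m"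
  shows "\<bar>g t - g s\<bar> \<le> 19 * (9/10) ^ m"
proof -
  define a b where "a = nat \<lfloor>s * 2 ^ m\<rfloor>" and "b = nat \<lfloor>t * 2 ^ m\<rfloor>"
  have ab: "real a \<le> s * 2 ^ m" "s * 2 ^ m < real a + 1" "real b \<le> t * 2 ^ m" "t * 2 ^ m < real b + 1"
    using st by (auto simp: of_nat_nat a_def b_def)
  have "s * 2 ^ m \<le> t * 2 ^ m" "t * 2 ^ m \<le> s * 2 ^ m + 1" "t * 2 ^ m \<le> 2 ^ m"
    using st by (auto simp: field_simps)
  with ab have "real a < real (b + 1)" "real b < real (a + 2)" "real b \<le> real (2 ^ m)"
    unfolding of_nat_add of_nat_power of_nat_numeral of_nat_1 by linarith+
  then have "(b = a \<or> b = Suc a)" "b \<le> 2 ^ m"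
    by (simp_all only: of_nat_less_iff of_nat_le_iff) linarith
  then have "\<bar>g (real b / 2 ^ m) - g (real a / 2 ^ m)\<bar> \<le> (9/10) ^ m"
    using step[of m a] by (auto simp del: of_nat_Suc)
  moreover have "\<bar>g s - g (real a / 2 ^ m)\<bar> \<le> 9 * (9/10) ^ m"
    unfolding a_def using st by (intro dyadic_modulus_dist[OF cont step]) auto
  moreover have "\<bar>g t - g (real b / 2 ^ m)\<bar> \<le> 9 * (9/10) ^ m"
    unfolding b_def using st by (intro dyadic_modulus_dist[OF cont step]) auto
  ultimately show ?thesis by linarith
qed

text \<open>Take \<open>t'\<close> as the first time at or below \<open>a\<close>, and then
  \<open>s'\<close> as the last time before \<open>t'\<close> at or above \<open>b\<close>. Between
  them the path is above \<open>a\<close> by the first choice and below \<open>b\<close> by the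
  second.\<close>

lemma continuous_on_downcrossing:
  fixes X :: "real \<Rightarrow> real"
  assumes cont: "continuous_on {s..t} X" and "s \<le> t" and "a \<le> b" "b \<le> X s" "X t \<le> a"
  obtains s' t' where "s \<le> s'" "s' \<le> t'" "t' \<le> t" "X s' = b" "X t' = a"
    "\<And>r. s' \<le> r \<Longrightarrow> r \<le> t' \<Longrightarrow> X r \<in> {a..b}"
proof -
  define T where "T = {r\<in>{s..t}. X r \<le> a}"
  have "T = {s..t} \<inter> X -` {..a}" by (auto simp: T_def)
  then have "closed T" using continuous_closed_preimage[OF cont] by simp
  moreover have "T \<noteq> {}" "bdd_below T" using assms by (auto simp: T_def)
  ultimately have T: "Inf T \<in> T" by (metis closed_contains_Inf)
  define t' where "t' = Inf T"
  have t': "s \<le> t'" "t' \<le> t" "X t' \<le> a" using T by (auto simp: T_def t'_def)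
  have before: "a < X r" if "s \<le> r" "r < t'" for r
    using cInf_lower[OF _ \<open>bdd_below T\<close>, of r] that t' by (force simp: T_def t'_def)
  have cont': "continuous_on {s..t'} X" using cont t' by (auto intro: continuous_on_subset)
  have Xt': "X t' = a"
  proof -
    obtain r where r: "s \<le> r" "r \<le> t'" "X r = a"
      using IVT2'[OF t'(3) _ t'(1) cont'] assms by auto
    then show ?thesis using before[of r] by (cases "r = t'") auto
  qed
  define S where "S = {r\<in>{s..t'}. b \<le> X r}"
  have "S = {s..t'} \<inter> X -` {b..}" by (auto simp: S_def)
  then have "closed S" using continuous_closed_preimage[OF cont'] by simp
  moreover have "S \<noteq> {}" "bdd_above S" using assms t' by (auto simp: S_def)
  ultimately have S: "Sup S \<in> S" by (metis closed_contains_Sup)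
  define s' where "s' = Sup S"
  have s': "s \<le> s'" "s' \<le> t'" "b \<le> X s'" using S by (auto simp: S_def s'_def)
  have after: "X r < b" if "s' < r" "r \<le> t'" for r
    using cSup_upper[OF _ \<open>bdd_above S\<close>, of r] that s' by (force simp: S_def s'_def)
  have cont'': "continuous_on {s'..t'} X" using cont' s' by (auto intro: continuous_on_subset)
  have Xs': "X s' = b"
  proof -
    obtain r where r: "s' \<le> r" "r \<le> t'" "X r = b"
      using IVT2'[OF _ s'(3,2) cont''] Xt' assms by auto
    then show ?thesis using after[of r] by (cases "r = s'") auto
  qed
  show ?thesis
  proof
    show "X r \<in> {a..b}" if "s' \<le> r" "r \<le> t'" for r
      using before[of r] after[of r] that Xs' Xt' s' \<open>a \<le> b\<close>
      by (cases "r = s'"; cases "r = t'") auto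
  qed (use s' t' Xs' Xt' in auto)
qed

text \<open>\<open>I\<close> is the drift integral. A large rise of \<open>W\<close> on the first half of the window forces \<open>X\<close> to the
  upper barrier, a large fall on the second half forces it down to the lower one, and between
  the two the path traverses \<open>[a, b]\<close> free of reflection, at a speed limited by the modulus of \<open>W\<close>.\<close>

lemma reflected_traversal:
  fixes X W L R I :: "real \<Rightarrow> real"
  assumes cont: "continuous_on {0..} X" and range: "\<And>t. 0 \<le> t \<Longrightarrow> X t \<in> {l..u}"
    and eq: "\<And>t. 0 \<le> t \<Longrightarrow> X t = x + I t + \<sigma> * W t + L t - R t"
    and I: "\<And>s t. 0 \<le> s \<Longrightarrow> s \<le> t \<Longrightarrow> \<bar>I t - I s\<bar> \<le> B * (t - s)"
    and L_mono: "\<And>s t. 0 \<le> s \<Longrightarrow> s \<le> t \<Longrightarrow> L s \<le> L t"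
    and R_mono: "\<And>s t. 0 \<le> s \<Longrightarrow> s \<le> t \<Longrightarrow> R s \<le> R t"
    and L_const: "\<And>s t. 0 \<le> s \<Longrightarrow> s \<le> t \<Longrightarrow> (\<And>r. s \<le> r \<Longrightarrow> r \<le> t \<Longrightarrow> l < X r) \<Longrightarrow> L s = L t"
    and R_const: "\<And>s t. 0 \<le> s \<Longrightarrow> s \<le> t \<Longrightarrow> (\<And>r. s \<le> r \<Longrightarrow> r \<le> t \<Longrightarrow> X r < u) \<Longrightarrow> R s = R t"
    and ab: "l < a" "a < b" "b < u" and "0 < \<sigma>" "0 \<le> B"
    and k: "0 \<le> k" and K: "u - l + B \<le> \<sigma> * K"
    and up: "K < W (k + 1/2) - W k" and down: "W (k + 1/2 + 1/2) - W (k + 1/2) < - K"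
    and h: "0 < h" "B * h \<le> (b - a) / 2"
    and modulus: "\<And>s t. k \<le> s \<Longrightarrow> s \<le> t \<Longrightarrow> t \<le> k + 1 \<Longrightarrow> t - s \<le> h \<Longrightarrow> \<sigma> * \<bar>W t - W s\<bar> < (b - a) / 2"
  obtains s t where "k \<le> s" "s + h \<le> t" "t \<le> k + 1" "\<And>r. s \<le> r \<Longrightarrow> r \<le> t \<Longrightarrow> X r \<in> {a..b}"
proof -
  \<comment> \<open>If \<open>X\<close> missed \<open>u\<close>, then \<open>R\<close> would be
    frozen while \<open>L\<close> can only push upwards. With the drift costing at most
    \<open>B / 2\<close>, the rise of \<open>\<sigma> * W\<close> by more than
    \<open>u - l + B\<close> would carry \<open>X\<close> out of \<open>[l, u]\<close>.\<close>
  have "\<exists>s. k \<le> s \<and> s \<le> k + 1/2 \<and> X s = u"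
  proof (rule ccontr)
    assume "\<not> ?thesis"
    then have "X r < u" if "k \<le> r" "r \<le> k + 1/2" for r
      using range[of r] that k by force
    then have "R k = R (k + 1/2)" using k by (intro R_const) auto
    moreover have "\<sigma> * K < \<sigma> * (W (k + 1/2) - W k)" using up \<open>0 < \<sigma>\<close> by simp
    ultimately show False
      using eq[of k] eq[of "k + 1/2"] k I[of k "k + 1/2"] L_mono[of k "k + 1/2"] K
        range[of k] range[of "k + 1/2"] \<open>0 \<le> B\<close> by (auto simp: algebra_simps)
  qed
  then obtain s0 where s0: "k \<le> s0" "s0 \<le> k + 1/2" "X s0 = u" by blast
  \<comment> \<open>Mirror image: without contact with \<open>l\<close>, the process
    \<open>L\<close> is frozen and \<open>R\<close> can only push downwards.\<close>
  have "\<exists>s. k + 1/2 \<le> s \<and> s \<le> k + 1 \<and> X s = l"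
  proof (rule ccontr)
    assume "\<not> ?thesis"
    then have "l < X r" if "k + 1/2 \<le> r" "r \<le> k + 1" for r
      using range[of r] that k by force
    then have "L (k + 1/2) = L (k + 1/2 + 1/2)" using k by (intro L_const) auto
    moreover have "\<sigma> * (W (k + 1/2 + 1/2) - W (k + 1/2)) < \<sigma> * (- K)"
      using mult_strict_left_mono[OF down \<open>0 < \<sigma>\<close>] .
    ultimately show False
      using eq[of "k + 1/2"] eq[of "k + 1/2 + 1/2"] k I[of "k + 1/2" "k + 1/2 + 1/2"] 
        R_mono[of "k + 1/2" "k + 1/2 + 1/2"] K
        range[of "k + 1/2"] range[of "k + 1/2 + 1/2"] \<open>0 \<le> B\<close> by (auto simp: algebra_simps)
  qed
  then obtain t0 where t0: "k + 1/2 \<le> t0" "t0 \<le> k + 1" "X t0 = l" by blast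
  obtain s t where st: "s0 \<le> s" "s \<le> t" "t \<le> t0" "X s = b" "X t = a"
    and between: "\<And>r. s \<le> r \<Longrightarrow> r \<le> t \<Longrightarrow> X r \<in> {a..b}"
    using continuous_on_downcrossing[of s0 t0 X a b] continuous_on_subset[OF cont] s0 t0 k ab
    by (auto simp: subset_eq)
  have "0 \<le> s" using st s0 k by auto
  have "l < X r" "X r < u" if "s \<le> r" "r \<le> t" for r using between[OF that] ab by auto
  then have "L s = L t" "R s = R t"
    using st \<open>0 \<le> s\<close> by (intro L_const R_const; simp)+
  then have "b - a = - (I t - I s) - \<sigma> * (W t - W s)"
    using eq[of s] eq[of t] st \<open>0 \<le> s\<close> by (auto simp: algebra_simps)
  also have "\<dots> \<le> B * (t - s) + \<sigma> * \<bar>W t - W s\<bar>"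
  proof -
    have "- (\<sigma> * (W t - W s)) \<le> \<sigma> * \<bar>W t - W s\<bar>"
      using \<open>0 < \<sigma>\<close> by (simp add: flip: mult_minus_right)
    then show ?thesis using I[of s t] st \<open>0 \<le> s\<close> by linarith
  qed
  finally have *: "b - a \<le> B * (t - s) + \<sigma> * \<bar>W t - W s\<bar>" .
  \<comment> \<open>Within time \<open>h\<close> drift and noise each account for at most half of
    the distance \<open>b - a\<close>, the noise for strictly less.\<close>
  have "h < t - s"
  proof (rule ccontr)
    assume "\<not> h < t - s"
    then have "\<sigma> * \<bar>W t - W s\<bar> < (b - a) / 2" using st s0 t0 by (intro modulus) auto
    moreover have "B * (t - s) \<le> B * h" using \<open>\<not> h < t - s\<close> \<open>0 \<le> B\<close> by (intro mult_left_mono) auto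
    ultimately have "b - a < (b - a) / 2 + (b - a) / 2"
      by (intro le_less_trans[OF * add_le_less_mono] order_trans[OF _ h(2)])
    then show False by simp
  qed
  with st s0 t0 between that[of s t] show ?thesis by auto
qed

text \<open>The mass of \<open>(s, t]\<close> under the path measure is the increment of
  \<open>A\<close>. It is dominated by the vanishing integral, because the integrand equals 1 along
  the whole interval.\<close>

lemma stieltjes_const:
  assumes cont: "continuous_on {0..} (\<lambda>t. A t \<omega>)" and mono: "mono_on {0..} (\<lambda>t. A t \<omega>)"
    and null: "(\<integral>\<^sup>+t\<in>{0..}. indicator S (X t) \<partial>stieltjes A \<omega>) = 0"
    and st: "0 \<le> s" "s \<le> t" "\<And>r. s \<le> r \<Longrightarrow> r \<le> t \<Longrightarrow> X r \<in> S"
  shows "A s \<omega> = A t \<omega>"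
proof -
  let ?G = "\<lambda>t. A (max 0 t) \<omega>"
  have "continuous_on UNIV ?G"
    by (intro continuous_on_compose2[OF cont] continuous_intros) auto
  then have "continuous (at_right a) ?G" for a
    using continuous_on_eq_continuous_at continuous_at_imp_continuous_within by blast
  then have "ennreal (?G t - ?G s) = emeasure (stieltjes A \<omega>) {s<..t}"
    unfolding stieltjes_def using st mono
    by (subst emeasure_interval_measure_Ioc) (auto simp: mono_on_def)
  also have "\<dots> = (\<integral>\<^sup>+r. indicator {s<..t} r \<partial>stieltjes A \<omega>)"
    by (simp add: stieltjes_def)
  also have "\<dots> \<le> (\<integral>\<^sup>+t\<in>{0..}. indicator S (X t) \<partial>stieltjes A \<omega>)"
    using st by (intro nn_integral_mono) (auto simp: indicator_def)
  finally have "?G t \<le> ?G s" using null by (simp add: ennreal_eq_0_iff)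
  moreover have "?G s \<le> ?G t" using st mono by (auto simp: mono_on_def)
  ultimately show ?thesis using st by simp
qed

section \<open>The stochastic integral\<close>

lemma LBINT_eq_integral:
  fixes g :: "real \<Rightarrow> real"
  shows "continuous_on {a..b} g \<Longrightarrow> (LBINT s:{a..b}. g s) = integral {a..b} g"
  by (intro set_borel_integral_eq_integral(2) borel_integrable_atLeastAtMost')

lemma integral_diff_Icc:
  fixes g :: "real \<Rightarrow> real"
  assumes "continuous_on {0..} g" "0 \<le> a" "a \<le> b"
  shows "integral {0..b} g - integral {0..a} g = integral {a..b} g"
  using Henstock_Kurzweil_Integration.integral_combine[of 0 a b g] assms continuous_on_subset[OF assms(1), of "{0..b}"]
  by (auto simp: integrable_continuous_real)

lemma continuous_on_grid_modulus:
  fixes g :: "real \<Rightarrow> real"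
  assumes cont: "continuous_on {0..} g" and "0 < \<epsilon>"
  shows "\<forall>\<^sub>F k in sequentially. \<forall>a\<in>{0..T}. \<forall>b\<in>{0..T}. \<bar>b - a\<bar> \<le> 1 / real (Suc k) \<longrightarrow> \<bar>g a - g b\<bar> < \<epsilon>"
proof -
  have "uniformly_continuous_on {0..T} g"
    using continuous_on_subset[OF cont] by (intro compact_uniformly_continuous) auto
  then obtain d where d: "0 < d" "\<And>a b. a \<in> {0..T} \<Longrightarrow> b \<in> {0..T} \<Longrightarrow> \<bar>b - a\<bar> < d \<Longrightarrow> \<bar>g a - g b\<bar> < \<epsilon>"
    using \<open>0 < \<epsilon>\<close> unfolding uniformly_continuous_on_def dist_real_def by (metis abs_minus_commute)
  have "\<forall>\<^sub>F k in sequentially. 1 / real (Suc k) < d"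
    using order_tendstoD(2)[OF LIMSEQ_inverse_real_of_nat d(1)] by (simp add: inverse_eq_divide)
  then show ?thesis
  proof eventually_elim
    case (elim k)
    then show ?case using d(2) by fastforce
  qed
qed

text \<open>This is the drift part of the elementary integrals. On one cell, replacing
  \<open>g\<close> by its left value changes the integral of the square by at most oscillation times
  \<open>C\<close> times length, and the lengths add up to \<open>T\<close>. Cells of mesh
  \<open>1 / Suc k\<close>, numbering \<open>Suc k * Suc k\<close>, both refine and eventually cover
  \<open>[0, T]\<close>.\<close>

lemma riemann_stieltjes_tendsto:
  fixes g :: "real \<Rightarrow> real"
  assumes cont: "continuous_on {0..} g" and C: "\<And>t. 0 \<le> t \<Longrightarrow> \<bar>g t\<bar> \<le> C" and "0 \<le> T"
  shows "(\<lambda>k. \<Sum>i<Suc k * Suc k. g (real i / real (Suc k)) *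
      (integral {0..min T (real (Suc i) / real (Suc k))} g - integral {0..min T (real i / real (Suc k))} g))
    \<longlonglongrightarrow> integral {0..T} (\<lambda>t. (g t)\<^sup>2)"
proof (rule LIMSEQ_I)
  fix \<epsilon> :: real assume "0 < \<epsilon>"
  define G where "G t = integral {0..t} g" for t
  define Q where "Q t = integral {0..t} (\<lambda>t. (g t)\<^sup>2)" for t
  have "0 \<le> C" using C[of 0] by auto
  \<comment> \<open>Oscillation allowed on a cell, giving a total error
    \<open>\<eta> * C * T < \<epsilon>\<close>. The added ones keep the denominator positive when
    \<open>C\<close> or \<open>T\<close> is 0.\<close>
  define \<eta> where "\<eta> = \<epsilon> / ((C + 1) * (T + 1))"
  have "0 < \<eta>" using \<open>0 < \<epsilon>\<close> \<open>0 \<le> C\<close> \<open>0 \<le> T\<close> by (auto simp: \<eta>_def)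
  have cont2: "continuous_on {0..} (\<lambda>t. (g t)\<^sup>2)" by (intro continuous_intros cont)
  have cell: "\<bar>g a * (G b - G a) - (Q b - Q a)\<bar> \<le> \<eta> * C * (b - a)"
    if ab: "0 \<le> a" "a \<le> b" and close: "\<And>s. a \<le> s \<Longrightarrow> s \<le> b \<Longrightarrow> \<bar>g a - g s\<bar> \<le> \<eta>" for a b
  proof -
    have gc: "continuous_on {a..b} g" using ab by (auto intro: continuous_on_subset[OF cont])
    have "g a * (G b - G a) - (Q b - Q a) = g a * integral {a..b} g - integral {a..b} (\<lambda>t. (g t)\<^sup>2)"
      unfolding G_def Q_def using integral_diff_Icc cont cont2 ab by simp
    also have "\<dots> = integral {a..b} (\<lambda>s. g a * g s - (g s)\<^sup>2)"
      using gc by (subst integral_diff)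
        (auto intro!: integrable_continuous_real continuous_intros)
    also have "norm \<dots> \<le> \<eta> * C * (b - a)"
    proof (rule integral_bound[OF ab(2)])
      show "norm (g a * g s - (g s)\<^sup>2) \<le> \<eta> * C" if "s \<in> {a..b}" for s
      proof -
        have "g a * g s - (g s)\<^sup>2 = (g a - g s) * g s" by (simp add: power2_eq_square algebra_simps)
        then show ?thesis
          using close[of s] C[of s] that ab \<open>0 < \<eta>\<close> by (auto simp: abs_mult intro!: mult_mono)
      qed
    qed (use gc in \<open>auto intro!: continuous_intros\<close>)
    finally show ?thesis by simp
  qed
  obtain k0 where k0: "\<And>k a b. k0 \<le> k \<Longrightarrow> a \<in> {0..T} \<Longrightarrow> b \<in> {0..T} \<Longrightarrow>
      \<bar>b - a\<bar> \<le> 1 / real (Suc k) \<Longrightarrow> \<bar>g a - g b\<bar> < \<eta>"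
    using continuous_on_grid_modulus[OF cont \<open>0 < \<eta>\<close>, of T] unfolding eventually_sequentially by blast
  have "norm ((\<Sum>i<Suc k * Suc k. g (real i / real (Suc k)) *
      (G (min T (real (Suc i) / real (Suc k))) - G (min T (real i / real (Suc k))))) - Q T) < \<epsilon>"
    \<comment> \<open>The summand involving \<open>T\<close> makes the grid reach \<open>T\<close>,
      so that the truncated sums telescope to the full integral.\<close>
    if k: "k0 + nat \<lceil>T\<rceil> \<le> k" for k
  proof -
    define t where "t i = min T (real i / real (Suc k))" for i
    have t: "0 \<le> t i" "t i \<le> T" "t i \<le> t (Suc i)" for i
      using \<open>0 \<le> T\<close> by (auto simp: t_def min_def divide_right_mono field_simps)
    have "T \<le> real (Suc k)" using k by linarith
    moreover have "real (Suc k * Suc k) / real (Suc k) = real (Suc k)"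
      unfolding of_nat_mult by simp
    ultimately have tn: "t (Suc k * Suc k) = T" by (simp only: t_def min_def if_True)
    have t0: "t 0 = 0" using \<open>0 \<le> T\<close> by (simp add: t_def)
    have cell': "\<bar>g (real i / real (Suc k)) * (G (t (Suc i)) - G (t i)) - (Q (t (Suc i)) - Q (t i))\<bar>
        \<le> \<eta> * C * (t (Suc i) - t i)" for i
    proof (cases "real i / real (Suc k) \<le> T")
      case True
      then have ti: "t i = real i / real (Suc k)" by (simp add: t_def)
      have "real (Suc i) / real (Suc k) = real i / real (Suc k) + 1 / real (Suc k)"
        by (simp add: add_divide_distrib)
      then have "t (Suc i) \<le> t i + 1 / real (Suc k)" by (simp add: ti) (simp add: t_def)
      then have "\<bar>g (t i) - g s\<bar> \<le> \<eta>" if "t i \<le> s" "s \<le> t (Suc i)" for s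
        using that k t[of i] t[of "Suc i"] by (intro less_imp_le[OF k0[of k]]) auto
      then show ?thesis using cell[OF t(1,3), of i] unfolding ti by blast
    next
      case False
      moreover have "real i / real (Suc k) \<le> real (Suc i) / real (Suc k)" by (intro divide_right_mono) auto
      ultimately have "t i = T" "t (Suc i) = T" by (auto simp: t_def)
      then show ?thesis by simp
    qed
    have "(\<Sum>i<Suc k * Suc k. Q (t (Suc i)) - Q (t i)) = Q T"
      unfolding sum_lessThan_telescope[of "\<lambda>i. Q (t i)"] tn t0 by (simp add: Q_def)
    then have "(\<Sum>i<Suc k * Suc k. g (real i / real (Suc k)) * (G (t (Suc i)) - G (t i))) - Q T
      = (\<Sum>i<Suc k * Suc k. g (real i / real (Suc k)) * (G (t (Suc i)) - G (t i)) - (Q (t (Suc i)) - Q (t i)))"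
      by (simp add: sum_subtractf)
    also have "\<bar>\<dots>\<bar> \<le> (\<Sum>i<Suc k * Suc k. \<eta> * C * (t (Suc i) - t i))"
      by (intro order_trans[OF sum_abs] sum_mono cell')
    also have "\<dots> = \<eta> * C * (t (Suc k * Suc k) - t 0)"
      unfolding sum_distrib_left[symmetric] sum_lessThan_telescope ..
    also have "\<dots> = \<eta> * C * T" by (simp only: tn t0) simp
    also have "\<dots> < \<eta> * ((C + 1) * (T + 1))"
    proof -
      have "C * T < (C + 1) * (T + 1)" using \<open>0 \<le> C\<close> \<open>0 \<le> T\<close> by (simp add: algebra_simps)
      then show ?thesis using \<open>0 < \<eta>\<close> by (simp only: mult.assoc mult_less_cancel_left_pos)
    qed
    also have "\<dots> = \<epsilon>" using \<open>0 \<le> C\<close> \<open>0 \<le> T\<close> by (simp add: \<eta>_def)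
    finally show ?thesis by (simp add: t_def)
  qed
  then show "\<exists>no. \<forall>k\<ge>no. norm ((\<Sum>i<Suc k * Suc k. g (real i / real (Suc k)) *
      (integral {0..min T (real (Suc i) / real (Suc k))} g - integral {0..min T (real i / real (Suc k))} g))
      - integral {0..T} (\<lambda>t. (g t)\<^sup>2)) < \<epsilon>"
    unfolding G_def Q_def by blast
qed

lemma floor_divide_tendsto: "(\<lambda>k. real_of_int \<lfloor>s * real (Suc k)\<rfloor> / real (Suc k)) \<longlonglongrightarrow> s"
proof (rule tendsto_sandwich)
  show "(\<lambda>k. s - inverse (real (Suc k))) \<longlonglongrightarrow> s"
    using tendsto_diff[OF tendsto_const LIMSEQ_inverse_real_of_nat, of s] by simp
  have "(s * real (Suc k) - 1) / real (Suc k) \<le> real_of_int \<lfloor>s * real (Suc k)\<rfloor> / real (Suc k)" for k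
    by (intro divide_right_mono) linarith+
  then show "\<forall>\<^sub>F k in sequentially. s - inverse (real (Suc k)) \<le> real_of_int \<lfloor>s * real (Suc k)\<rfloor> / real (Suc k)"
    by (auto simp: diff_divide_distrib inverse_eq_divide)
  have "real_of_int \<lfloor>s * real (Suc k)\<rfloor> / real (Suc k) \<le> s" for k
    by (simp add: divide_le_eq del: of_nat_Suc)
  then show "\<forall>\<^sub>F k in sequentially. real_of_int \<lfloor>s * real (Suc k)\<rfloor> / real (Suc k) \<le> s" by auto
qed simp

text \<open>Rounding time down to a grid leaves countably many measurable pieces, so
  \<open>V k\<close> is jointly measurable. Continuity of paths transfers this to the limit, and
  Fubini measurability gives the integral. The \<open>max 0\<close> avoids negative times, where
  nothing is known of \<open>Z\<close>.\<close>

lemma borel_measurable_path_integral: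
  fixes Z :: "real \<Rightarrow> 'a \<Rightarrow> real"
  assumes meas: "\<And>t. 0 \<le> t \<Longrightarrow> Z t \<in> borel_measurable M"
    and cont: "\<And>\<omega>. \<omega> \<in> space M \<Longrightarrow> continuous_on {0..} (\<lambda>t. Z t \<omega>)" and "0 \<le> a"
  shows "(\<lambda>\<omega>. LBINT t:{a..b}. Z t \<omega>) \<in> borel_measurable M"
proof -
  define V where "V k p = Z (max 0 (real_of_int \<lfloor>snd p * real (Suc k)\<rfloor> / real (Suc k))) (fst p)"
    for k and p :: "'a \<times> real"
  have "V k \<in> borel_measurable (M \<Otimes>\<^sub>M lborel)" for k
  proof -
    have "(\<lambda>p. Z (max 0 (real_of_int j / real (Suc k))) (fst p)) \<in> borel_measurable (M \<Otimes>\<^sub>M lborel)" for j :: int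
      by (intro measurable_compose[OF measurable_fst] meas) simp
    moreover have "(\<lambda>p. \<lfloor>snd p * real (Suc k)\<rfloor>) \<in> measurable (M \<Otimes>\<^sub>M lborel) (count_space UNIV)"
      by measurable
    ultimately show ?thesis
      unfolding V_def by (rule measurable_compose_countable)
  qed
  moreover have "(\<lambda>k. V k p) \<longlonglongrightarrow> Z (max 0 (snd p)) (fst p)" if "p \<in> space (M \<Otimes>\<^sub>M lborel)" for p
    unfolding V_def using that
    by (intro continuous_on_tendsto_compose[OF cont] tendsto_max tendsto_const floor_divide_tendsto)
      (auto simp: space_pair_measure)
  ultimately have [measurable]: "(\<lambda>p. Z (max 0 (snd p)) (fst p)) \<in> borel_measurable (M \<Otimes>\<^sub>M lborel)"
    by (rule borel_measurable_LIMSEQ_real[rotated])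
  have "(\<lambda>\<omega>. \<integral>t. indicator {a..b} t *\<^sub>R Z (max 0 t) \<omega> \<partial>lborel) \<in> borel_measurable M"
    by (rule lborel.borel_measurable_lebesgue_integral) (simp add: split_beta')
  moreover have "(LBINT t:{a..b}. Z t \<omega>) = (\<integral>t. indicator {a..b} t *\<^sub>R Z (max 0 t) \<omega> \<partial>lborel)" for \<omega>
    unfolding set_lebesgue_integral_def using \<open>0 \<le> a\<close>
    by (intro Bochner_Integration.integral_cong) (auto simp: indicator_def max_def)
  ultimately show ?thesis by simp
qed

text \<open>Dominated convergence for indicators; it converts pathwise limits into limits in
  probability.\<close>

lemma (in finite_measure) measure_tendsto_0:
  assumes [measurable]: "\<And>k. E k \<in> sets M" and "AE \<omega> in M. \<forall>\<^sub>F k in sequentially. \<omega> \<notin> E k"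
  shows "(\<lambda>k. measure M (E k)) \<longlonglongrightarrow> 0"
proof -
  have "(\<lambda>k. \<integral>\<omega>. indicator (E k) \<omega> \<partial>M) \<longlonglongrightarrow> (\<integral>\<omega>. 0 \<partial>M :: real)"
  proof (rule integral_dominated_convergence[where w="\<lambda>_. 1"])
    show "AE \<omega> in M. (\<lambda>k. indicator (E k) \<omega>) \<longlonglongrightarrow> (0 :: real)"
      using assms(2)
      by eventually_elim (auto intro!: tendsto_eventually elim: eventually_mono)
  qed (auto simp: indicator_def)
  then show ?thesis by simp
qed

text \<open>Makes deterministic grid times admissible in \<open>simple_predictable\<close>:
  intersecting an \<open>F c\<close> event with \<open>c \<le> t\<close> yields either the event
  itself or the empty set.\<close>

lemma (in filtration) measurable_pre_sigma_const:
  assumes g: "g \<in> measurable (F c) N"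
  shows "g \<in> measurable (pre_sigma (\<lambda>_. c)) N"
proof (rule measurableI)
  fix A assume "A \<in> sets N"
  then have A: "g -` A \<inter> \<Omega> \<in> sets (F c)" using measurable_sets[OF g] by (simp add: space_F)
  moreover have "{\<omega> \<in> g -` A \<inter> \<Omega>. c \<le> t} = (if c \<le> t then g -` A \<inter> \<Omega> else {})" for t by auto
  ultimately have "{\<omega> \<in> g -` A \<inter> \<Omega>. c \<le> t} \<in> sets (F t)" for t
    using sets_F_mono[of c t] by auto
  then show "g -` A \<inter> space (pre_sigma (\<lambda>_. c)) \<in> sets (pre_sigma (\<lambda>_. c))"
    unfolding space_pre_sigma by (intro sets_pre_sigmaI stopping_time_const) auto
qed (use measurable_space[OF g] in \<open>simp add: space_pre_sigma space_F\<close>)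

section \<open>Isometry for sums over deterministic grids\<close>

context brownian
begin

text \<open>Induction on the number of cells. The cross term vanishes since
  \<open>S n * \<xi> n\<close> is known at time \<open>t n\<close>, while the next increment is
  independent of it with mean 0; the new square costs at most \<open>C\<^sup>2\<close> times the
  cell length. Measurability and integrability are carried along because the independence argument
  uses them.\<close>

lemma ito_isometry_le:
  fixes t :: "nat \<Rightarrow> real" and \<xi> :: "nat \<Rightarrow> 'a \<Rightarrow> real"
  assumes t: "0 \<le> t 0" "\<And>i. t i \<le> t (Suc i)"
    and \<xi>: "\<And>i. \<xi> i \<in> borel_measurable (F (t i))" "\<And>i \<omega>. \<omega> \<in> space M \<Longrightarrow> \<bar>\<xi> i \<omega>\<bar> \<le> C"
  defines "S \<equiv> \<lambda>n \<omega>. \<Sum>i<n. \<xi> i \<omega> * inc (t i) (t (Suc i)) \<omega>"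
  shows "S n \<in> borel_measurable (F (t n)) \<and> integrable M (\<lambda>\<omega>. (S n \<omega>)\<^sup>2) \<and>
    expectation (\<lambda>\<omega>. (S n \<omega>)\<^sup>2) \<le> C\<^sup>2 * (t n - t 0)"
proof (induction n)
  case 0
  then show ?case by (simp add: S_def)
next
  case (Suc n)
  have t_nonneg: "0 \<le> t i" for i 
  proof (induction i)
    case (Suc i)
    then show ?case using t(2)[of i] by linarith
  qed (fact t(1))
  have S_Suc: "S (Suc n) \<omega> = S n \<omega> + \<xi> n \<omega> * inc (t n) (t (Suc n)) \<omega>" for \<omega>
    by (simp add: S_def)
  show ?case
  \<comment> \<open>Empty cells do occur: truncation at \<open>T\<close> collapses all cells beyond
    \<open>T\<close>, and an increment of length 0 has no normal density.\<close>
  proof (cases "t n = t (Suc n)")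
    case True
    then show ?thesis using Suc by (simp add: S_Suc)
  next
    case False
    then have less: "t n < t (Suc n)" using t(2)[of n] by simp
    let ?d = "inc (t n) (t (Suc n))"
    have SF: "S n \<in> borel_measurable (F (t n))" and S2: "integrable M (\<lambda>\<omega>. (S n \<omega>)\<^sup>2)"
      and ES: "expectation (\<lambda>\<omega>. (S n \<omega>)\<^sup>2) \<le> C\<^sup>2 * (t n - t 0)"
      using Suc by auto
    have [measurable]: "S n \<in> borel_measurable M" "\<xi> n \<in> borel_measurable M" "?d \<in> borel_measurable M"
      by (intro measurable_F[OF SF] measurable_F[OF \<xi>(1)] borel_measurable_diff W_measurable t_nonneg)+
    have S1: "integrable M (S n)"
      using S2 by (rule square_integrable_imp_integrable[rotated]) simp
    have d1: "integrable M ?d" and d2: "integrable M (\<lambda>\<omega>. (?d \<omega>)\<^sup>2)"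
      using integrable_inc_power[OF t_nonneg less, of 1] integrable_inc_power[OF t_nonneg less, of 2] by auto
    have SxiF: "(\<lambda>\<omega>. S n \<omega> * \<xi> n \<omega>) \<in> borel_measurable (F (t n))"
      using SF \<xi>(1) by measurable
    have Sxi: "integrable M (\<lambda>\<omega>. S n \<omega> * \<xi> n \<omega>)"
    proof (rule Bochner_Integration.integrable_bound)
      show "integrable M (\<lambda>\<omega>. C * \<bar>S n \<omega>\<bar>)" using S1 by auto
      have "\<bar>S n \<omega>\<bar> * \<bar>\<xi> n \<omega>\<bar> \<le> \<bar>C\<bar> * \<bar>S n \<omega>\<bar>" if "\<omega> \<in> space M" for \<omega>
        using \<xi>(2)[OF that, of n] by (subst mult.commute) (intro mult_right_mono; auto)
      then show "AE \<omega> in M. norm (S n \<omega> * \<xi> n \<omega>) \<le> norm (C * \<bar>S n \<omega>\<bar>)"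
        by (auto simp: abs_mult)
    qed measurable
    have cross: "integrable M (\<lambda>\<omega>. (S n \<omega> * \<xi> n \<omega>) * ?d \<omega>)"
        "expectation (\<lambda>\<omega>. (S n \<omega> * \<xi> n \<omega>) * ?d \<omega>) = 0"
      using indep_var_integrable[OF indep_var_inc[OF t_nonneg less SxiF] Sxi d1]
        indep_var_lebesgue_integral[OF indep_var_inc[OF t_nonneg less SxiF] Sxi d1]
        expectation_inc[OF t_nonneg less] by auto
    have le: "(\<xi> n \<omega> * ?d \<omega>)\<^sup>2 \<le> C\<^sup>2 * (?d \<omega>)\<^sup>2" if "\<omega> \<in> space M" for \<omega>
      using \<xi>(2)[OF that, of n] by (auto simp: power_mult_distrib intro!: mult_right_mono abs_le_square_iff[THEN iffD1])
    have sq: "integrable M (\<lambda>\<omega>. (\<xi> n \<omega> * ?d \<omega>)\<^sup>2)"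
      by (rule Bochner_Integration.integrable_bound[OF integrable_mult_right[OF d2, of "C\<^sup>2"]])
        (use le in auto)
    have eq: "(S (Suc n) \<omega>)\<^sup>2 = (S n \<omega>)\<^sup>2 + 2 * ((S n \<omega> * \<xi> n \<omega>) * ?d \<omega>) + (\<xi> n \<omega> * ?d \<omega>)\<^sup>2" for \<omega>
      by (simp add: S_Suc power2_eq_square algebra_simps)
    have "expectation (\<lambda>\<omega>. (\<xi> n \<omega> * ?d \<omega>)\<^sup>2) \<le> expectation (\<lambda>\<omega>. C\<^sup>2 * (?d \<omega>)\<^sup>2)"
      using sq d2 le by (intro integral_mono) auto
    also have "\<dots> = C\<^sup>2 * (t (Suc n) - t n)" using expectation_inc_square[OF t_nonneg less] by simp
    finally have "expectation (\<lambda>\<omega>. (\<xi> n \<omega> * ?d \<omega>)\<^sup>2) \<le> C\<^sup>2 * (t (Suc n) - t n)" .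
    moreover have "expectation (\<lambda>\<omega>. (S (Suc n) \<omega>)\<^sup>2)
        = expectation (\<lambda>\<omega>. (S n \<omega>)\<^sup>2) + expectation (\<lambda>\<omega>. (\<xi> n \<omega> * ?d \<omega>)\<^sup>2)"
      unfolding eq using S2 cross sq by simp
    ultimately have "expectation (\<lambda>\<omega>. (S (Suc n) \<omega>)\<^sup>2) \<le> C\<^sup>2 * (t (Suc n) - t 0)"
      using ES by (simp only: right_diff_distrib)
    moreover have "integrable M (\<lambda>\<omega>. (S (Suc n) \<omega>)\<^sup>2)"
      unfolding eq using S2 cross sq by auto
    moreover have "S (Suc n) \<in> borel_measurable (F (t (Suc n)))"
    proof -
      have [measurable]: "S n \<in> borel_measurable (F (t (Suc n)))" "\<xi> n \<in> borel_measurable (F (t (Suc n)))"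
        "W (t n) \<in> borel_measurable (F (t (Suc n)))" "W (t (Suc n)) \<in> borel_measurable (F (t (Suc n)))"
        using less by (intro W_F t_nonneg measurable_F_mono[OF _ SF] measurable_F_mono[OF _ \<xi>(1)]; simp)+
      show ?thesis unfolding S_Suc[abs_def] by measurable
    qed
    ultimately show ?thesis by blast
  qed
qed

end

section \<open>Grid approximation of the stochastic integral\<close>

context brownian
begin

lemma adapted_measurable: "adapted F Z \<Longrightarrow> 0 \<le> t \<Longrightarrow> Z t \<in> borel_measurable M"
  unfolding adapted_def by (blast intro: measurable_F)

lemma grid_simple_predictable:
  assumes "adapted F H"
  shows "simple_predictable M F n (\<lambda>i _. real i / real (Suc k)) (H 0) (\<lambda>i. H (real i / real (Suc k)))"
proof -
  interpret filtration "space M" F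
    using filtered by (simp add: filtered_prob_space_def)
  show ?thesis
    using assms unfolding simple_predictable_def adapted_def
    by (auto intro!: stopping_time_const measurable_pre_sigma_const divide_right_mono)
qed

text \<open>On a cell the simple process is the value of \<open>H\<close> at the left end, so
  uniform continuity on \<open>[0, T]\<close> controls the distance. The bad event runs over
  uncountably many times; it is covered by the measurable \<open>E k\<close>, which uses only
  rational times of the cell.\<close>

lemma grid_ucp:
  assumes H: "adapted F H" and cont: "continuous_process M H"
  shows "ucp_tendsto M (\<lambda>k. simple_process (Suc k * Suc k) (\<lambda>i _. real i / real (Suc k)) (H 0)
    (\<lambda>i. H (real i / real (Suc k)))) H"
  unfolding ucp_tendsto_def
proof (intro allI impI)
  fix T \<epsilon> :: real assume "0 \<le> T" "0 < \<epsilon>"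
  have contH: "continuous_on {0..} (\<lambda>t. H t \<omega>)" if "\<omega> \<in> space M" for \<omega>
    using cont that by (simp add: continuous_process_def)
  have Hm: "H t \<in> borel_measurable M" if "0 \<le> t" for t
    using adapted_measurable[OF H that] .
  define I where "I k i = {r :: rat. 0 \<le> (of_rat r :: real) \<and> of_rat r \<le> T \<and> real i / real (Suc k) \<le> of_rat r \<and>
     of_rat r \<le> real (Suc i) / real (Suc k)}" for k i
  define E where "E k = (\<Union>i. \<Union>r\<in>I k i. {\<omega> \<in> space M. \<epsilon> < \<bar>H (real i / real (Suc k)) \<omega> - H (of_rat r) \<omega>\<bar>})" for k
  have E: "E k \<in> events" for k
    unfolding E_def
  proof (intro sets.countable_UN'' countableI_type)
    fix i r assume "r \<in> I k i"
    then have [measurable]: "H (of_rat r) \<in> borel_measurable M" "H (real i / real (Suc k)) \<in> borel_measurable M"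
      by (auto simp: I_def intro!: Hm)
    show "{\<omega> \<in> space M. \<epsilon> < \<bar>H (real i / real (Suc k)) \<omega> - H (of_rat r) \<omega>\<bar>} \<in> events" by measurable
  qed
  have "(\<lambda>k. prob (E k)) \<longlonglongrightarrow> 0"
  proof (intro measure_tendsto_0[OF E] AE_I2)
    fix \<omega> assume "\<omega> \<in> space M"
    show "\<forall>\<^sub>F k in sequentially. \<omega> \<notin> E k"
      using continuous_on_grid_modulus[OF contH[OF \<open>\<omega> \<in> space M\<close>] \<open>0 < \<epsilon>\<close>, of T]
    proof eventually_elim
      case (elim k)
      show ?case
      proof
        assume "\<omega> \<in> E k"
        then obtain i r where ir: "0 \<le> (of_rat r :: real)" "of_rat r \<le> T" "real i / real (Suc k) \<le> of_rat r"
          "of_rat r \<le> real (Suc i) / real (Suc k)" "\<epsilon> < \<bar>H (real i / real (Suc k)) \<omega> - H (of_rat r) \<omega>\<bar>"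
          unfolding E_def I_def by blast
        have "real (Suc i) / real (Suc k) = real i / real (Suc k) + 1 / real (Suc k)"
          by (simp add: add_divide_distrib)
        then have "\<bar>of_rat r - real i / real (Suc k)\<bar> \<le> 1 / real (Suc k)" using ir by linarith
        moreover have "real i / real (Suc k) \<in> {0..T}" "of_rat r \<in> {0..T}" using ir by auto
        ultimately show False using elim ir(5) by fastforce
      qed
    qed
  qed
  then have lim: "(\<lambda>k. emeasure M (E k)) \<longlonglongrightarrow> 0"
    unfolding emeasure_eq_measure ennreal_0[symmetric] by (rule tendsto_ennrealI)
  show "(\<lambda>k. outer_measure_of M {\<omega> \<in> space M. \<exists>s\<in>{0..T}. \<epsilon> < \<bar>simple_process (Suc k * Suc k)
      (\<lambda>i _. real i / real (Suc k)) (H 0) (\<lambda>i. H (real i / real (Suc k))) s \<omega> - H s \<omega>\<bar>}) \<longlonglongrightarrow> 0"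
  proof (rule tendsto_sandwich[OF _ _ tendsto_const lim])
    show "\<forall>\<^sub>F k in sequentially. outer_measure_of M {\<omega> \<in> space M. \<exists>s\<in>{0..T}. \<epsilon> < \<bar>simple_process (Suc k * Suc k)
        (\<lambda>i _. real i / real (Suc k)) (H 0) (\<lambda>i. H (real i / real (Suc k))) s \<omega> - H s \<omega>\<bar>} \<le> emeasure M (E k)"
      using eventually_ge_at_top[of "nat \<lceil>T\<rceil>"]
    proof eventually_elim
      case (elim k)
      let ?t = "\<lambda>i. real i / real (Suc k)"
      have sub: "\<omega> \<in> E k" if "\<omega> \<in> space M" "0 \<le> s" "s \<le> T"
        and *: "\<epsilon> < \<bar>simple_process (Suc k * Suc k) (\<lambda>i _. ?t i) (H 0) (\<lambda>i. H (?t i)) s \<omega> - H s \<omega>\<bar>" for \<omega> s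
      proof (cases "s = 0")
        case True
        have "(\<Sum>j<Suc k * Suc k. H (?t j) \<omega> * indicator {?t j<..?t (Suc j)} s) = 0"
          by (intro sum.neutral ballI) (simp add: True indicator_def divide_less_0_iff)
        then have "simple_process (Suc k * Suc k) (\<lambda>i _. ?t i) (H 0) (\<lambda>i. H (?t i)) s \<omega> = H s \<omega>"
          unfolding simple_process_def by (simp only:) (simp add: True)
        then show ?thesis using * \<open>0 < \<epsilon>\<close> by simp
      next
        case False
        with that have "0 < s" by simp
        \<comment> \<open>Cells are open on the left and closed on the right, hence the ceiling
          minus one.\<close>
        define i where "i = nat \<lceil>s * real (Suc k)\<rceil> - 1"
        have "0 < s * real (Suc k)" using \<open>0 < s\<close> by simp
        then have i: "real i < s * real (Suc k)" "s * real (Suc k) \<le> real (Suc i)"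
          unfolding i_def by linarith+
        then have it: "?t i < s" "s \<le> ?t (Suc i)"
          by (simp_all only: divide_less_eq le_divide_eq of_nat_0_less_iff zero_less_Suc if_True)
        have "s * real (Suc k) \<le> real (Suc k) * real (Suc k)"
          using elim \<open>s \<le> T\<close> by (intro mult_right_mono) linarith+
        then have "real i < real (Suc k * Suc k)" using i unfolding of_nat_mult by linarith
        then have "i < Suc k * Suc k" by (simp only: of_nat_less_iff)
        have other: "s \<notin> {?t j<..?t (Suc j)}" if "j \<noteq> i" for j
        proof
          assume "s \<in> {?t j<..?t (Suc j)}"
          then have "real j < s * real (Suc k)" "s * real (Suc k) \<le> real (Suc j)"
            by (simp_all only: greaterThanAtMost_iff divide_less_eq le_divide_eq of_nat_0_less_iff zero_less_Suc if_True)
          with i have "real j < real (Suc i)" "real i < real (Suc j)" by linarith+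
          then show False using \<open>j \<noteq> i\<close> by simp
        qed
        have ind: "indicator {?t j<..?t (Suc j)} s = (if j = i then 1 else 0 :: real)" for j
          using other it by (auto simp del: of_nat_Suc)
        have "(\<Sum>j<n. H (?t j) \<omega> * indicator {?t j<..?t (Suc j)} s) = H (?t i) \<omega>" if "i < n" for n
          using that unfolding ind by (simp add: if_distrib cong: if_cong)
        then have "simple_process (Suc k * Suc k) (\<lambda>i _. ?t i) (H 0) (\<lambda>i. H (?t i)) s \<omega> = H (?t i) \<omega>"
          unfolding simple_process_def using \<open>s \<noteq> 0\<close> \<open>i < Suc k * Suc k\<close> by (simp only:) simp
        then have big: "\<epsilon> < \<bar>H (?t i) \<omega> - H s \<omega>\<bar>" using * by simp
        have "isCont (\<lambda>t. H t \<omega>) s"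
          using contH[OF \<open>\<omega> \<in> space M\<close>] \<open>0 < s\<close>
          by (auto intro: continuous_on_interior simp: interior_Ici[where b="-1"])
        then have "((\<lambda>r. \<bar>H (?t i) \<omega> - H r \<omega>\<bar>) \<longlongrightarrow> \<bar>H (?t i) \<omega> - H s \<omega>\<bar>) (at s)"
          by (intro tendsto_intros) (simp add: isCont_def)
        \<comment> \<open>Moving \<open>s\<close> to a nearby rational on its left keeps it in the
          same cell and below \<open>T\<close>.\<close>
        then have "\<forall>\<^sub>F r in at_left s. \<epsilon> < \<bar>H (?t i) \<omega> - H r \<omega>\<bar>"
          using order_tendstoD(1)[OF _ big] filterlim_at_split by blast
        then obtain b where b: "b < s" "\<And>r. b < r \<Longrightarrow> r < s \<Longrightarrow> \<epsilon> < \<bar>H (?t i) \<omega> - H r \<omega>\<bar>"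
          unfolding eventually_at_left_field by blast
        obtain r where "r \<in> \<rat>" "max b (?t i) < r" "r < s"
          using Rats_dense_in_real[of "max b (?t i)" s] b it by auto
        then obtain r' where r': "max b (?t i) < of_rat r'" "of_rat r' < s" by (auto elim: Rats_cases)
        have "0 \<le> ?t i" by simp
        with r' it \<open>s \<le> T\<close> have "r' \<in> I k i"
          unfolding I_def mem_Collect_eq max_less_iff_conj by (intro conjI) linarith+
        then show ?thesis using b(2)[of "of_rat r'"] r' \<open>\<omega> \<in> space M\<close> unfolding E_def by auto
      qed
      have "outer_measure_of M {\<omega> \<in> space M. \<exists>s\<in>{0..T}. \<epsilon> < \<bar>simple_process (Suc k * Suc k)
        (\<lambda>i _. ?t i) (H 0) (\<lambda>i. H (?t i)) s \<omega> - H s \<omega>\<bar>} \<le> outer_measure_of M (E k)"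
        using sub by (intro outer_measure_of_mono) auto
      then show ?case using E by simp
    qed
  qed simp
qed

text \<open>The error splits into three parts: \<open>N\<close> against the grid sum
  \<open>J k\<close>, small by the definition of the integral; the drift part of \<open>J k\<close>
  against \<open>\<theta> * Q\<close>, small by Riemann sums; and \<open>\<sigma> * S k\<close>,
  bounded by the isometry and Chebyshev uniformly in \<open>k\<close>. Letting \<open>k\<close> grow
  leaves only the third, and 9 comes from allotting \<open>\<epsilon> / 3\<close> to each
  part.\<close>

lemma stochastic_integral_error:
  fixes H Y N :: "real \<Rightarrow> 'a \<Rightarrow> real"
  assumes H: "adapted F H" "continuous_process M H"
    and C: "\<And>\<omega> t. \<omega> \<in> space M \<Longrightarrow> 0 \<le> t \<Longrightarrow> \<bar>H t \<omega>\<bar> \<le> C"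
    and Y: "adapted F Y"
      "AE \<omega> in M. \<forall>t\<ge>0. Y t \<omega> = y0 + \<theta> * (LBINT s:{0..t}. H s \<omega>) + \<sigma> * W t \<omega>"
    and N: "is_stochastic_integral M F H Y N" and "0 \<le> T" "0 < \<epsilon>"
  shows "prob {\<omega> \<in> space M. \<epsilon> < \<bar>N T \<omega> - \<theta> * (LBINT s:{0..T}. (H s \<omega>)\<^sup>2)\<bar>} \<le> 9 * \<sigma>\<^sup>2 * C\<^sup>2 * T / \<epsilon>\<^sup>2"
proof -
  let ?t = "\<lambda>k i. real i / real (Suc k)"
  let ?t' = "\<lambda>k i. min T (?t k i)"
  define J where "J k \<omega> = simple_integral (Suc k * Suc k) (\<lambda>i _. ?t k i) (\<lambda>i. H (?t k i)) Y T \<omega>" for k \<omega>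
  \<comment> \<open>\<open>H\<close> is evaluated at the truncated time to be measurable at the
    start of its truncated cell; \<open>J\<close> uses the untruncated time. They differ only in
    cells starting beyond \<open>T\<close>, whose increments are 0.\<close>
  define S where "S k \<omega> = (\<Sum>i<Suc k * Suc k. H (?t' k i) \<omega> * inc (?t' k i) (?t' k (Suc i)) \<omega>)" for k \<omega>
  define Q where "Q \<omega> = (LBINT s:{0..T}. (H s \<omega>)\<^sup>2)" for \<omega>
  have contH: "continuous_on {0..} (\<lambda>t. H t \<omega>)" if "\<omega> \<in> space M" for \<omega>
    using H that by (simp add: continuous_process_def)
  have Hm: "H t \<in> borel_measurable M" and Ym: "Y t \<in> borel_measurable M" if "0 \<le> t" for t
    using adapted_measurable H(1) Y(1) that by blast+
  have [measurable]: "N T \<in> borel_measurable M"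
    using N adapted_measurable \<open>0 \<le> T\<close> unfolding is_stochastic_integral_def by blast
  have [measurable]: "J k \<in> borel_measurable M" for k
    unfolding J_def simple_integral_def using \<open>0 \<le> T\<close>
    by (intro borel_measurable_sum borel_measurable_times borel_measurable_diff Hm Ym) auto
  have [measurable]: "Q \<in> borel_measurable M"
    unfolding Q_def using contH Hm by (intro borel_measurable_path_integral continuous_intros) auto
  have t'_nonneg: "0 \<le> ?t' k i" and t'_mono: "?t' k i \<le> ?t' k (Suc i)" for k i
    using \<open>0 \<le> T\<close> divide_right_mono[of "real i" "real (Suc i)" "real (Suc k)"] by auto
  have iso: "S k \<in> borel_measurable (F (?t' k (Suc k * Suc k))) \<and> integrable M (\<lambda>\<omega>. (S k \<omega>)\<^sup>2) \<and>
      expectation (\<lambda>\<omega>. (S k \<omega>)\<^sup>2) \<le> C\<^sup>2 * (?t' k (Suc k * Suc k) - ?t' k 0)" for k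
    unfolding S_def
  proof (rule ito_isometry_le)
    show "H (?t' k i) \<in> borel_measurable (F (?t' k i))" for i
      using H(1) t'_nonneg unfolding adapted_def by blast
    show "\<bar>H (?t' k i) \<omega>\<bar> \<le> C" if "\<omega> \<in> space M" for i \<omega>
      using C[OF that t'_nonneg] .
  qed (rule t'_nonneg t'_mono)+
  have [measurable]: "S k \<in> borel_measurable M" for k using iso measurable_F by blast
  have ES: "expectation (\<lambda>\<omega>. (S k \<omega>)\<^sup>2) \<le> C\<^sup>2 * T" for k
  proof -
    have "C\<^sup>2 * (?t' k (Suc k * Suc k) - ?t' k 0) \<le> C\<^sup>2 * T"
      using \<open>0 \<le> T\<close> by (intro mult_left_mono) auto
    then show ?thesis using iso[of k] by linarith
  qed
  define e where "e = \<epsilon> / 3"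
  have "0 < e" using \<open>0 < \<epsilon>\<close> by (simp add: e_def)
  let ?A = "\<lambda>k. {\<omega> \<in> space M. e < \<bar>J k \<omega> - N T \<omega>\<bar>}"
  let ?B = "\<lambda>k. {\<omega> \<in> space M. e < \<bar>J k \<omega> - \<sigma> * S k \<omega> - \<theta> * Q \<omega>\<bar>}"
  let ?C = "\<lambda>k. {\<omega> \<in> space M. e < \<bar>\<sigma> * S k \<omega>\<bar>}"
  have "(\<lambda>k. prob (?A k)) \<longlonglongrightarrow> 0"
  proof -
    have "ucp_tendsto M (\<lambda>k. simple_integral (Suc k * Suc k) (\<lambda>i _. ?t k i) (\<lambda>i. H (?t k i)) Y) N"
      using N unfolding is_stochastic_integral_def
      by (elim conjE allE[of _ "\<lambda>k. Suc k * Suc k"] allE[of _ "\<lambda>k i _. ?t k i"] allE[of _ "\<lambda>_. H 0"]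
          allE[of _ "\<lambda>k i. H (?t k i)"] mp) (intro conjI allI grid_simple_predictable grid_ucp H)
    then have lim: "(\<lambda>k. outer_measure_of M {\<omega> \<in> space M. \<exists>s\<in>{0..T}. e <
        \<bar>simple_integral (Suc k * Suc k) (\<lambda>i _. ?t k i) (\<lambda>i. H (?t k i)) Y s \<omega> - N s \<omega>\<bar>}) \<longlonglongrightarrow> 0"
      unfolding ucp_tendsto_def using \<open>0 \<le> T\<close> \<open>0 < e\<close> by blast
    have "(\<lambda>k. ennreal (prob (?A k))) \<longlonglongrightarrow> 0"
    proof (rule tendsto_sandwich[OF _ _ tendsto_const lim])
      have "ennreal (prob (?A k)) = outer_measure_of M (?A k)" for k
        by (simp add: emeasure_eq_measure)
      also have "\<dots> k \<le> outer_measure_of M {\<omega> \<in> space M. \<exists>s\<in>{0..T}. e <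
        \<bar>simple_integral (Suc k * Suc k) (\<lambda>i _. ?t k i) (\<lambda>i. H (?t k i)) Y s \<omega> - N s \<omega>\<bar>}" for k
        using \<open>0 \<le> T\<close> unfolding J_def by (intro outer_measure_of_mono) auto
      finally show "\<forall>\<^sub>F k in sequentially. ennreal (prob (?A k)) \<le> outer_measure_of M {\<omega> \<in> space M. \<exists>s\<in>{0..T}. e <
        \<bar>simple_integral (Suc k * Suc k) (\<lambda>i _. ?t k i) (\<lambda>i. H (?t k i)) Y s \<omega> - N s \<omega>\<bar>}"
        by auto
    qed simp
    then show ?thesis unfolding ennreal_0[symmetric] by (subst (asm) tendsto_ennreal_iff) auto
  qed
  moreover have "(\<lambda>k. prob (?B k)) \<longlonglongrightarrow> 0"
  proof (rule measure_tendsto_0)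
    show "AE \<omega> in M. \<forall>\<^sub>F k in sequentially. \<omega> \<notin> ?B k"
      using Y(2) AE_space
    proof eventually_elim
      case (elim \<omega>)
      let ?g = "\<lambda>t. H t \<omega>"
      let ?R = "\<lambda>k. \<Sum>i<Suc k * Suc k. ?g (?t k i) * (integral {0..?t' k (Suc i)} ?g - integral {0..?t' k i} ?g)"
      have Icc: "(LBINT s:{0..b}. ?g s) = integral {0..b} ?g" "(LBINT s:{0..b}. (?g s)\<^sup>2) = integral {0..b} (\<lambda>s. (?g s)\<^sup>2)" for b
        using continuous_on_subset[OF contH[OF elim(2)], of "{0..b}"]
        by (intro LBINT_eq_integral continuous_intros; auto)+
      have "?R \<longlonglongrightarrow> integral {0..T} (\<lambda>t. (?g t)\<^sup>2)"
        using riemann_stieltjes_tendsto[OF contH[OF elim(2)] C[OF elim(2)] \<open>0 \<le> T\<close>] .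
      then have "(\<lambda>k. \<bar>\<theta> * ?R k - \<theta> * Q \<omega>\<bar>) \<longlonglongrightarrow> \<bar>\<theta> * Q \<omega> - \<theta> * Q \<omega>\<bar>"
        unfolding Q_def Icc by (intro tendsto_intros)
      then have ev: "\<forall>\<^sub>F k in sequentially. \<bar>\<theta> * ?R k - \<theta> * Q \<omega>\<bar> < e"
        using \<open>0 < e\<close> by (intro order_tendstoD(2)) auto
      have "J k \<omega> - \<sigma> * S k \<omega> = \<theta> * ?R k" for k
      proof -
        have "?g (?t k i) * (Y (?t' k (Suc i)) \<omega> - Y (?t' k i) \<omega>) - \<sigma> * (H (?t' k i) \<omega> * inc (?t' k i) (?t' k (Suc i)) \<omega>)
            = \<theta> * (?g (?t k i) * (integral {0..?t' k (Suc i)} ?g - integral {0..?t' k i} ?g))" for i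
        proof (cases "?t k i \<le> T")
          case True
          then have "?t' k i = ?t k i" by simp
          moreover have "Y t \<omega> = y0 + \<theta> * integral {0..t} ?g + \<sigma> * W t \<omega>"
            if "t = ?t k i \<or> t = ?t' k (Suc i)" for t
          proof -
            have "0 \<le> t" using that
            proof
              assume "t = ?t' k (Suc i)"
              then show ?thesis using t'_nonneg by blast
            qed simp
            then show ?thesis using elim(1) unfolding Icc by blast
          qed
          then have "Y (?t k i) \<omega> = y0 + \<theta> * integral {0..?t k i} ?g + \<sigma> * W (?t k i) \<omega>"
            "Y (?t' k (Suc i)) \<omega> = y0 + \<theta> * integral {0..?t' k (Suc i)} ?g + \<sigma> * W (?t' k (Suc i)) \<omega>"
            by blast+
          ultimately show ?thesis by (simp only: algebra_simps)
        next
          case False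
          then have "?t' k i = T" "?t' k (Suc i) = T"
            using divide_right_mono[of "real i" "real (Suc i)" "real (Suc k)"] by auto
          then show ?thesis by simp
        qed
        then show ?thesis
          unfolding J_def S_def simple_integral_def sum_distrib_left sum_subtractf[symmetric] by simp
      qed
      with ev show ?case by (auto elim!: eventually_mono)
    qed
  qed measurable
  moreover have C_le: "prob (?C k) \<le> \<sigma>\<^sup>2 * C\<^sup>2 * T / e\<^sup>2" for k
  proof -
    have int: "integrable M (\<lambda>\<omega>. (\<sigma> * S k \<omega>)\<^sup>2)"
      using iso[of k] by (simp add: power_mult_distrib)
    have "prob (?C k) \<le> prob {\<omega> \<in> space M. e\<^sup>2 \<le> (\<sigma> * S k \<omega>)\<^sup>2}"
    proof (rule finite_measure_mono)
      have "e\<^sup>2 \<le> y\<^sup>2" if "e < \<bar>y\<bar>" for y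
        using power_mono[of e "\<bar>y\<bar>" 2] that \<open>0 < e\<close> by simp
      then show "?C k \<subseteq> {\<omega> \<in> space M. e\<^sup>2 \<le> (\<sigma> * S k \<omega>)\<^sup>2}" by auto
    qed measurable
    also have "\<dots> \<le> expectation (\<lambda>\<omega>. (\<sigma> * S k \<omega>)\<^sup>2) / e\<^sup>2"
      using \<open>0 < e\<close> by (intro integral_Markov_inequality_measure[where A="space M"] int) auto
    also have "\<dots> \<le> \<sigma>\<^sup>2 * (C\<^sup>2 * T) / e\<^sup>2"
      using ES[of k] by (simp add: power_mult_distrib divide_right_mono mult_left_mono)
    finally show ?thesis by (simp add: mult.assoc)
  qed
  ultimately have lim: "(\<lambda>k. prob (?A k) + prob (?B k) + \<sigma>\<^sup>2 * C\<^sup>2 * T / e\<^sup>2) \<longlonglongrightarrow> 0 + 0 + \<sigma>\<^sup>2 * C\<^sup>2 * T / e\<^sup>2"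
    by (intro tendsto_add tendsto_const)
  have "prob {\<omega> \<in> space M. \<epsilon> < \<bar>N T \<omega> - \<theta> * Q \<omega>\<bar>} \<le> prob (?A k) + prob (?B k) + \<sigma>\<^sup>2 * C\<^sup>2 * T / e\<^sup>2" for k
  proof -
    have "prob {\<omega> \<in> space M. \<epsilon> < \<bar>N T \<omega> - \<theta> * Q \<omega>\<bar>} \<le> prob (?A k \<union> ?B k \<union> ?C k)"
    proof (rule finite_measure_mono)
      show "{\<omega> \<in> space M. \<epsilon> < \<bar>N T \<omega> - \<theta> * Q \<omega>\<bar>} \<subseteq> ?A k \<union> ?B k \<union> ?C k"
      proof
        fix \<omega> assume \<omega>: "\<omega> \<in> {\<omega> \<in> space M. \<epsilon> < \<bar>N T \<omega> - \<theta> * Q \<omega>\<bar>}"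
        have "N T \<omega> - \<theta> * Q \<omega> = (N T \<omega> - J k \<omega>) + (J k \<omega> - \<sigma> * S k \<omega> - \<theta> * Q \<omega>) + \<sigma> * S k \<omega>"
          by simp
        also have "\<bar>\<dots>\<bar> \<le> \<bar>J k \<omega> - N T \<omega>\<bar> + \<bar>J k \<omega> - \<sigma> * S k \<omega> - \<theta> * Q \<omega>\<bar> + \<bar>\<sigma> * S k \<omega>\<bar>"
          by (rule order_trans[OF abs_triangle_ineq add_right_mono[OF abs_triangle_ineq[THEN order_trans]]]) simp
        finally have "3 * e < \<bar>J k \<omega> - N T \<omega>\<bar> + \<bar>J k \<omega> - \<sigma> * S k \<omega> - \<theta> * Q \<omega>\<bar> + \<bar>\<sigma> * S k \<omega>\<bar>"
          using \<omega> by (simp add: e_def)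
        then have "e < \<bar>J k \<omega> - N T \<omega>\<bar> \<or> e < \<bar>J k \<omega> - \<sigma> * S k \<omega> - \<theta> * Q \<omega>\<bar> \<or> e < \<bar>\<sigma> * S k \<omega>\<bar>"
          by (rule contrapos_pp) (simp only: de_Morgan_disj not_less, linarith)
        then show "\<omega> \<in> ?A k \<union> ?B k \<union> ?C k" using \<omega> by auto
      qed
    qed measurable
    also have "\<dots> \<le> prob (?A k) + prob (?B k) + prob (?C k)"
      by (intro order_trans[OF measure_Un_le] add_right_mono measure_Un_le) measurable
    finally show ?thesis using C_le[of k] by linarith
  qed
  then have "prob {\<omega> \<in> space M. \<epsilon> < \<bar>N T \<omega> - \<theta> * Q \<omega>\<bar>} \<le> 0 + 0 + \<sigma>\<^sup>2 * C\<^sup>2 * T / e\<^sup>2"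
    by (intro LIMSEQ_le_const[OF lim]) auto
  also have "\<dots> = 9 * \<sigma>\<^sup>2 * C\<^sup>2 * T / \<epsilon>\<^sup>2" by (simp add: e_def power_divide)
  finally show ?thesis unfolding Q_def .
qed

end

section \<open>Consistency\<close>

lemma integral_sum_unit_intervals:
  fixes g :: "real \<Rightarrow> real"
  assumes "continuous_on {0..} g"
  shows "integral {0..real n} g = (\<Sum>k<n. integral {real k..real k + 1} g)"
proof (induction n)
  case (Suc n)
  then show ?case using integral_diff_Icc[OF assms, of "real n" "real n + 1"] by (simp add: add.commute)
qed simp

text \<open>\<open>reflected_traversal\<close> applied path by path with
  \<open>h = 1 / 2 ^ m\<close>: the path stays in \<open>[a, b]\<close> for at least that long,
  where the integrand is at least \<open>\<delta>\<^sup>2\<close>. The exceptional null set does not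
  depend on \<open>k\<close>.\<close>

lemma (in brownian) reflected_occupation:
  assumes sde: "reflected_SDE M F W (\<lambda>y. \<theta> * f y) \<sigma> l u x X L R"
    and f: "continuous_on {l..u} f" "\<And>y. y \<in> {l..u} \<Longrightarrow> \<bar>f y\<bar> \<le> C"
    and ab: "l < a" "a < b" "b < u" and \<delta>: "0 \<le> \<delta>" "\<And>y. y \<in> {a..b} \<Longrightarrow> \<delta> \<le> \<bar>f y\<bar>"
    and "0 < \<sigma>" and K: "u - l + \<bar>\<theta>\<bar> * C \<le> \<sigma> * K"
    and m: "\<sigma> * (19 * (9/10) ^ m) < (b - a) / 2" "\<bar>\<theta>\<bar> * C * (1 / 2 ^ m) \<le> (b - a) / 2"
  shows "AE \<omega> in M. \<forall>k. \<omega> \<in> swing_event K m k \<longrightarrow>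
    1 / 2 ^ m * \<delta>\<^sup>2 \<le> integral {real k..real k + 1} (\<lambda>s. (f (X s \<omega>))\<^sup>2)"
proof -
  have eqs: "AE \<omega> in M. \<forall>t\<ge>0. X t \<omega> = x + (LBINT s:{0..t}. \<theta> * f (X s \<omega>)) + \<sigma> * W t \<omega> + L t \<omega> - R t \<omega>"
    "AE \<omega> in M. (\<integral>\<^sup>+t\<in>{0..}. indicator {l<..} (X t \<omega>) \<partial>stieltjes L \<omega>) = 0"
    "AE \<omega> in M. (\<integral>\<^sup>+t\<in>{0..}. indicator {..<u} (X t \<omega>) \<partial>stieltjes R \<omega>) = 0"
    using sde by (auto simp: reflected_SDE_def)
  show ?thesis
    using eqs AE_space
  proof (eventually_elim, intro allI impI)
    fix \<omega> k
    assume eq: "\<forall>t\<ge>0. X t \<omega> = x + (LBINT s:{0..t}. \<theta> * f (X s \<omega>)) + \<sigma> * W t \<omega> + L t \<omega> - R t \<omega>"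
      and L0: "(\<integral>\<^sup>+t\<in>{0..}. indicator {l<..} (X t \<omega>) \<partial>stieltjes L \<omega>) = 0"
      and R0: "(\<integral>\<^sup>+t\<in>{0..}. indicator {..<u} (X t \<omega>) \<partial>stieltjes R \<omega>) = 0"
      and \<omega>: "\<omega> \<in> space M" and swing: "\<omega> \<in> swing_event K m k"
    have X: "continuous_on {0..} (\<lambda>t. X t \<omega>)" "\<And>t. 0 \<le> t \<Longrightarrow> X t \<omega> \<in> {l..u}"
      and L: "continuous_on {0..} (\<lambda>t. L t \<omega>)" "mono_on {0..} (\<lambda>t. L t \<omega>)"
      and R: "continuous_on {0..} (\<lambda>t. R t \<omega>)" "mono_on {0..} (\<lambda>t. R t \<omega>)"
      using sde \<omega> by (auto simp: reflected_SDE_def continuous_process_def increasing_process_def)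
    let ?g = "\<lambda>t. f (X t \<omega>)"
    have g: "continuous_on {0..} ?g"
      by (rule continuous_on_compose2[OF f(1) X(1)]) (use X(2) in auto)
    have "0 \<le> C" using f(2)[of a] ab by auto
    define I where "I t = (LBINT s:{0..t}. \<theta> * f (X s \<omega>))" for t
    have I_bound: "\<bar>I t - I s\<bar> \<le> \<bar>\<theta>\<bar> * C * (t - s)" if st: "0 \<le> s" "s \<le> t" for s t
    proof -
      have \<theta>g: "continuous_on {0..} (\<lambda>t. \<theta> * ?g t)" by (intro continuous_intros g)
      have "I t - I s = integral {s..t} (\<lambda>t. \<theta> * ?g t)"
        unfolding I_def using st integral_diff_Icc[OF \<theta>g st] continuous_on_subset[OF \<theta>g]
        by (subst (1 2) LBINT_eq_integral) auto
      also have "norm \<dots> \<le> \<bar>\<theta>\<bar> * C * (t - s)"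
        using st X(2) f(2) continuous_on_subset[OF \<theta>g, of "{s..t}"]
        by (intro integral_bound) (auto simp: abs_mult intro!: mult_left_mono)
      finally show ?thesis by simp
    qed
    have up: "K < W (real k + 1/2) \<omega> - W (real k) \<omega>"
      and down: "W (real k + 1/2 + 1/2) \<omega> - W (real k + 1/2) \<omega> < - K"
      and smooth: "\<omega> \<in> smooth_event m k"
      using swing by (auto simp: swing_event_def)
    have modulus: "\<sigma> * \<bar>W t \<omega> - W s \<omega>\<bar> < (b - a) / 2"
      if st: "real k \<le> s" "s \<le> t" "t \<le> real k + 1" "t - s \<le> 1 / 2 ^ m" for s t
    proof -
      \<comment> \<open>Shifts the window to \<open>[0, 1]\<close>, where dyadic chaining is
        formulated.\<close>
      define w where "w r = W (real k + r) \<omega>" for r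
      have "\<bar>w (t - real k) - w (s - real k)\<bar> \<le> 19 * (9/10) ^ m"
      proof (rule dyadic_modulus[where g=w])
        show "continuous_on {0..1} w"
          unfolding w_def by (rule continuous_on_compose2[OF W_continuous[OF \<omega>]]) (auto intro!: continuous_intros)
        show "\<bar>w (real (Suc i) / 2 ^ j) - w (real i / 2 ^ j)\<bar> \<le> (9/10) ^ j" if "m \<le> j" "i < 2 ^ j" for i j
          using smooth that unfolding smooth_event_def w_def by blast
      qed (use st in auto)
      then have "\<sigma> * \<bar>W t \<omega> - W s \<omega>\<bar> \<le> \<sigma> * (19 * (9/10) ^ m)"
        using \<open>0 < \<sigma>\<close> by (simp add: w_def)
      then show ?thesis using m(1) by linarith
    qed
    obtain s t where st: "real k \<le> s" "s + 1 / 2 ^ m \<le> t" "t \<le> real k + 1"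
      and between: "\<And>r. s \<le> r \<Longrightarrow> r \<le> t \<Longrightarrow> X r \<omega> \<in> {a..b}"
    proof (rule reflected_traversal[where X="\<lambda>t. X t \<omega>" and W="\<lambda>t. W t \<omega>" and L="\<lambda>t. L t \<omega>"
          and R="\<lambda>t. R t \<omega>" and I=I and l=l and u=u and x=x and \<sigma>=\<sigma> and B="\<bar>\<theta>\<bar> * C" and a=a and b=b
          and k="real k" and K=K and h="1 / 2 ^ m"])
      show "X t \<omega> = x + I t + \<sigma> * W t \<omega> + L t \<omega> - R t \<omega>" if "0 \<le> t" for t
        using eq that by (simp add: I_def)
      show "L s \<omega> = L t \<omega>" if "0 \<le> s" "s \<le> t" "\<And>r. s \<le> r \<Longrightarrow> r \<le> t \<Longrightarrow> l < X r \<omega>" for s t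
        by (rule stieltjes_const[OF L L0 that(1,2)]) (use that in auto)
      show "R s \<omega> = R t \<omega>" if "0 \<le> s" "s \<le> t" "\<And>r. s \<le> r \<Longrightarrow> r \<le> t \<Longrightarrow> X r \<omega> < u" for s t
        by (rule stieltjes_const[OF R R0 that(1,2)]) (use that in auto)
      show "L s \<omega> \<le> L t \<omega>" "R s \<omega> \<le> R t \<omega>" if "0 \<le> s" "s \<le> t" for s t
        using L(2) R(2) that by (auto simp: mono_on_def)
    qed (use X I_bound ab \<open>0 < \<sigma>\<close> \<open>0 \<le> C\<close> K up down m(2) modulus in auto)
    have g2: "continuous_on S (\<lambda>r. (?g r)\<^sup>2)" if "S \<subseteq> {0..}" for S
      using continuous_on_subset[OF g that] by (intro continuous_intros)
    have "s \<le> t" using st by (smt (verit) zero_less_divide_1_iff zero_less_power)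
    have "1 / 2 ^ m * \<delta>\<^sup>2 \<le> (t - s) * \<delta>\<^sup>2"
      using st by (intro mult_right_mono) auto
    also have "\<dots> = integral {s..t} (\<lambda>r. \<delta>\<^sup>2)"
      using \<open>s \<le> t\<close> by simp
    also have "\<dots> \<le> integral {s..t} (\<lambda>r. (?g r)\<^sup>2)"
    proof (rule integral_le)
      show "(\<lambda>r. (?g r)\<^sup>2) integrable_on {s..t}" using st by (intro integrable_continuous_real g2) auto
      show "\<delta>\<^sup>2 \<le> (?g r)\<^sup>2" if "r \<in> {s..t}" for r
        using power_mono[OF \<delta>(2)[OF between] \<delta>(1), of r 2] that by simp
    qed auto
    also have "\<dots> \<le> integral {real k..real k + 1} (\<lambda>r. (?g r)\<^sup>2)"
      using st by (intro integral_subset_le integrable_continuous_real g2) auto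
    finally show "1 / 2 ^ m * \<delta>\<^sup>2 \<le> integral {real k..real k + 1} (\<lambda>s. (f (X s \<omega>))\<^sup>2)" .
  qed
qed

theorem theorem5:
  fixes M :: "'a measure" and F :: "real \<Rightarrow> 'a measure"
    and W X L R N :: "real \<Rightarrow> 'a \<Rightarrow> real"
    and f :: "real \<Rightarrow> real" and l u \<sigma> x \<theta>\<^sub>0 :: real
  assumes "filtered_prob_space M F"
    and "brownian_motion M F W"
    and "0 \<le> l" and "l < u" and "\<sigma> > 0" and "x \<in> {l..u}"
    and "\<exists>C. C-lipschitz_on {l..u} f"
    and "\<exists>y\<in>{l..u}. f y \<noteq> 0"
    and "reflected_SDE M F W (\<lambda>y. \<theta>\<^sub>0 * f y) \<sigma> l u x X L R"
    and "is_stochastic_integral M F (\<lambda>t \<omega>. f (X t \<omega>)) (\<lambda>t \<omega>. X t \<omega> - L t \<omega> + R t \<omega>) N"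
  shows "tendsto_in_prob M (lse f X N) \<theta>\<^sub>0"
proof -
  interpret brownian M F W using assms(1,2) by unfold_locales
  note \<open>l < u\<close> \<open>\<sigma> > 0\<close> and sde = assms(9)
  have f: "continuous_on {l..u} f" using assms(7) lipschitz_on_continuous_on by blast
  obtain C where C: "\<And>y. y \<in> {l..u} \<Longrightarrow> \<bar>f y\<bar> \<le> C"
    using compact_imp_bounded[OF compact_continuous_image[OF f compact_Icc]]
    unfolding bounded_iff real_norm_def by blast
  define H where "H t \<omega> = f (X t \<omega>)" for t \<omega>
  have X: "continuous_on {0..} (\<lambda>t. X t \<omega>)" "\<And>t. 0 \<le> t \<Longrightarrow> X t \<omega> \<in> {l..u}" if "\<omega> \<in> space M" for \<omega>
    using sde that by (auto simp: reflected_SDE_def continuous_process_def)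
  have contH: "continuous_on {0..} (\<lambda>t. H t \<omega>)" if "\<omega> \<in> space M" for \<omega>
    unfolding H_def by (rule continuous_on_compose2[OF f X(1)[OF that]]) (use X(2)[OF that] in auto)
  have HC: "\<bar>H t \<omega>\<bar> \<le> C" if "\<omega> \<in> space M" "0 \<le> t" for t \<omega>
    unfolding H_def using C X(2)[OF that] by blast
  have adapted: "adapted F X" "adapted F L" "adapted F R"
    using sde by (auto simp: reflected_SDE_def increasing_process_def)
  have H_adapted: "adapted F H"
    unfolding adapted_def
  proof (intro allI impI)
    fix t :: real assume "0 \<le> t"
    \<comment> \<open>\<open>f\<close> is known only on \<open>[l, u]\<close>; clamping its argument
      gives a Borel function on the line that agrees with \<open>f\<close> along
      \<open>X\<close>.\<close>
    have "continuous_on UNIV (\<lambda>y. f (max l (min u y)))"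
      using \<open>l < u\<close> by (intro continuous_on_compose2[OF f] continuous_intros) auto
    then have "(\<lambda>y. f (max l (min u y))) \<in> borel_measurable borel"
      by (rule borel_measurable_continuous_onI)
    moreover have "X t \<in> borel_measurable (F t)" using adapted(1) \<open>0 \<le> t\<close> by (simp add: adapted_def)
    ultimately have "(\<lambda>\<omega>. f (max l (min u (X t \<omega>)))) \<in> borel_measurable (F t)"
      by (rule measurable_compose[rotated])
    moreover have "(\<lambda>\<omega>. f (max l (min u (X t \<omega>)))) \<in> borel_measurable (F t) \<longleftrightarrow> H t \<in> borel_measurable (F t)"
      using X(2)[OF _ \<open>0 \<le> t\<close>] by (intro measurable_cong) (simp add: H_def)
    ultimately show "H t \<in> borel_measurable (F t)" by simp
  qed
  have Y_adapted: "adapted F (\<lambda>t \<omega>. X t \<omega> - L t \<omega> + R t \<omega>)"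
    using adapted unfolding adapted_def by (intro allI impI borel_measurable_add borel_measurable_diff) auto
  have "AE \<omega> in M. \<forall>t\<ge>0.
      X t \<omega> = x + (LBINT s:{0..t}. \<theta>\<^sub>0 * f (X s \<omega>)) + \<sigma> * W t \<omega> + L t \<omega> - R t \<omega>"
    using sde by (simp add: reflected_SDE_def)
  \<comment> \<open>Removing the reflection terms leaves drift plus scaled Brownian motion, the form
    of integrator treated by \<open>stochastic_integral_error\<close>.\<close>
  then have Y_eq: "AE \<omega> in M. \<forall>t\<ge>0.
      X t \<omega> - L t \<omega> + R t \<omega> = x + \<theta>\<^sub>0 * (LBINT s:{0..t}. H s \<omega>) + \<sigma> * W t \<omega>"
    by eventually_elim (simp add: H_def)
  define Q where "Q T \<omega> = (LBINT s:{0..T}. (H s \<omega>)\<^sup>2)" for T \<omega>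
  have error: "prob {\<omega> \<in> space M. \<epsilon> < \<bar>N T \<omega> - \<theta>\<^sub>0 * Q T \<omega>\<bar>} \<le> 9 * \<sigma>\<^sup>2 * C\<^sup>2 * T / \<epsilon>\<^sup>2"
    if "0 \<le> T" "0 < \<epsilon>" for T \<epsilon>
    unfolding Q_def
    using contH HC assms(10) that
    by (intro stochastic_integral_error[OF H_adapted _ _ Y_adapted Y_eq])
      (auto simp: continuous_process_def H_def[abs_def])
  have Q_meas: "(\<lambda>\<omega>. N T \<omega> - \<theta>\<^sub>0 * Q T \<omega>) \<in> borel_measurable M" if "0 \<le> T" for T
  proof -
    have "N T \<in> borel_measurable M"
      using assms(10) adapted_measurable that unfolding is_stochastic_integral_def by blast
    moreover have "Q T \<in> borel_measurable M"
      unfolding Q_def using contH adapted_measurable[OF H_adapted]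
      by (intro borel_measurable_path_integral borel_measurable_power continuous_intros) auto
    ultimately show ?thesis by measurable
  qed

  obtain a b \<delta> where ab: "l < a" "a < b" "b < u" and \<delta>: "0 < \<delta>" "\<And>y. y \<in> {a..b} \<Longrightarrow> \<delta> \<le> \<bar>f y\<bar>"
  proof -
    obtain y where y: "y \<in> {l..u}" "f y \<noteq> 0" using assms(8) by blast
    then obtain e where e: "0 < e" "\<And>z. z \<in> {l..u} \<Longrightarrow> \<bar>z - y\<bar> < e \<Longrightarrow> \<bar>f z - f y\<bar> < \<bar>f y\<bar> / 2"
      using f unfolding continuous_on_iff dist_real_def by (meson half_gt_zero zero_less_abs_iff)
    \<comment> \<open>The point \<open>y\<close> may be an endpoint of \<open>[l, u]\<close>. The
      middle third of \<open>[lo, hi]\<close> lies strictly inside \<open>(l, u)\<close> all the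
      same, and radius \<open>e / 2\<close> keeps it in the open neighbourhood of
      \<open>y\<close>.\<close>
    define lo hi where "lo = max l (y - e / 2)" and "hi = min u (y + e / 2)"
    have "l \<le> lo" "hi \<le> u" "lo < hi" "y - e / 2 \<le> lo" "hi \<le> y + e / 2"
      using y(1) e(1) \<open>l < u\<close> by (auto simp: lo_def hi_def)
    then have range: "z \<in> {l..u} \<and> \<bar>z - y\<bar> < e" if "z \<in> {(2 * lo + hi) / 3..(lo + 2 * hi) / 3}" for z
      using that e(1) by (auto simp: abs_less_iff)
    have "\<bar>f y\<bar> / 2 \<le> \<bar>f z\<bar>" if "z \<in> {(2 * lo + hi) / 3..(lo + 2 * hi) / 3}" for z
    proof -
      have "\<bar>f z - f y\<bar> < \<bar>f y\<bar> / 2" using e(2) range[OF that] by blast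
      then show ?thesis by linarith
    qed
    then show ?thesis
      using \<open>l \<le> lo\<close> \<open>hi \<le> u\<close> \<open>lo < hi\<close> y(2)
      by (intro that[of "(2 * lo + hi) / 3" "(lo + 2 * hi) / 3" "\<bar>f y\<bar> / 2"]) (auto simp: field_simps)
  qed
  define K where "K = (u - l + \<bar>\<theta>\<^sub>0\<bar> * C) / \<sigma>"
  obtain p where p: "0 < p"
    and swing: "\<forall>\<^sub>F m in sequentially. \<forall>k. \<forall>B\<in>sets (F (real k)). p * prob B \<le> prob (swing_event K m k \<inter> B)"
    using swing_event_prob_ge by blast
  have lims: "(\<lambda>m. \<sigma> * (19 * (9/10) ^ m)) \<longlonglongrightarrow> \<sigma> * (19 * 0)"
    "(\<lambda>m. \<bar>\<theta>\<^sub>0\<bar> * C * (1/2) ^ m) \<longlonglongrightarrow> \<bar>\<theta>\<^sub>0\<bar> * C * 0"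
    by (intro tendsto_intros LIMSEQ_power_zero; simp)+
  have "\<forall>\<^sub>F m in sequentially. \<sigma> * (19 * (9/10) ^ m) < (b - a) / 2"
    "\<forall>\<^sub>F m in sequentially. \<bar>\<theta>\<^sub>0\<bar> * C * (1/2) ^ m < (b - a) / 2"
    using ab by (intro order_tendstoD(2)[OF lims(1)] order_tendstoD(2)[OF lims(2)]; simp)+
  with swing have "\<forall>\<^sub>F m in sequentially. (\<forall>k. \<forall>B\<in>sets (F (real k)). p * prob B \<le> prob (swing_event K m k \<inter> B)) \<and>
      \<sigma> * (19 * (9/10) ^ m) < (b - a) / 2 \<and> \<bar>\<theta>\<^sub>0\<bar> * C * (1/2) ^ m < (b - a) / 2"
    by (simp add: eventually_conj_iff)
  \<comment> \<open>One level \<open>m\<close> serves three purposes: likely swings, small noise and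
    small drift over time \<open>1 / 2 ^ m\<close>.\<close>
  then obtain m where m: "\<And>k B. B \<in> sets (F (real k)) \<Longrightarrow> p * prob B \<le> prob (swing_event K m k \<inter> B)"
      "\<sigma> * (19 * (9/10) ^ m) < (b - a) / 2" "\<bar>\<theta>\<^sub>0\<bar> * C * (1/2) ^ m < (b - a) / 2"
    by (auto dest!: eventually_happens'[rotated] simp del: less_divide_eq_numeral1)
  obtain \<gamma> where \<gamma>: "0 < \<gamma>"
    and count: "(\<lambda>n. prob {\<omega> \<in> space M. (\<Sum>k<n. indicator (swing_event K m k) \<omega>) \<le> \<gamma> * real n}) \<longlonglongrightarrow> 0"
    using count_tendsto[OF p swing_event_F[OF order_refl] m(1)] by blast
  define c where "c = 1 / 2 ^ m * \<delta>\<^sup>2"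
  have "0 < c" using \<delta> by (simp add: c_def)
  have occupation: "AE \<omega> in M. \<forall>k. \<omega> \<in> swing_event K m k \<longrightarrow> c \<le> integral {real k..real k + 1} (\<lambda>s. (H s \<omega>)\<^sup>2)"
    unfolding c_def H_def using sde f C ab less_imp_le[OF \<delta>(1)] \<delta>(2) \<open>\<sigma> > 0\<close> _ m(2)
  proof (rule reflected_occupation)
    show "u - l + \<bar>\<theta>\<^sub>0\<bar> * C \<le> \<sigma> * K" using \<open>\<sigma> > 0\<close> by (simp add: K_def)
    show "\<bar>\<theta>\<^sub>0\<bar> * C * (1 / 2 ^ m) \<le> (b - a) / 2" using m(3) by (simp add: power_divide)
  qed
  have Q_ge: "AE \<omega> in M. \<forall>T n. real n \<le> T \<longrightarrow> c * (\<Sum>k<n. indicator (swing_event K m k) \<omega>) \<le> Q T \<omega>"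
    using occupation AE_space
  proof (eventually_elim, intro allI impI)
    fix \<omega> T n
    assume occ: "\<forall>k. \<omega> \<in> swing_event K m k \<longrightarrow> c \<le> integral {real k..real k + 1} (\<lambda>s. (H s \<omega>)\<^sup>2)"
      and \<omega>: "\<omega> \<in> space M" and n: "real n \<le> T"
    have H2: "continuous_on {0..} (\<lambda>s. (H s \<omega>)\<^sup>2)" by (intro continuous_intros contH \<omega>)
    have H2': "continuous_on {s..t} (\<lambda>s. (H s \<omega>)\<^sup>2)" if "0 \<le> s" for s t
      using that by (auto intro: continuous_on_subset[OF H2])
    have "c * (\<Sum>k<n. indicator (swing_event K m k) \<omega>) = (\<Sum>k<n. c * indicator (swing_event K m k) \<omega>)"
      by (rule sum_distrib_left)
    also have "\<dots> \<le> (\<Sum>k<n. integral {real k..real k + 1} (\<lambda>s. (H s \<omega>)\<^sup>2))"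
      using occ H2' by (intro sum_mono) (auto simp: indicator_def intro!: integral_nonneg integrable_continuous_real)
    also have "\<dots> = integral {0..real n} (\<lambda>s. (H s \<omega>)\<^sup>2)"
      by (rule integral_sum_unit_intervals[OF H2, symmetric])
    also have "\<dots> \<le> integral {0..T} (\<lambda>s. (H s \<omega>)\<^sup>2)"
      using n H2' by (intro integral_subset_le integrable_continuous_real) auto
    also have "\<dots> = Q T \<omega>"
      unfolding Q_def using H2' by (intro LBINT_eq_integral[symmetric]) auto
    finally show "c * (\<Sum>k<n. indicator (swing_event K m k) \<omega>) \<le> Q T \<omega>" .
  qed
  show ?thesis
    unfolding tendsto_in_prob_def
  proof (intro allI impI)
    fix \<epsilon> :: real assume "0 < \<epsilon>"
    \<comment> \<open>Growth rate of the denominator: gain \<open>c\<close> per good window,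
      frequency \<open>\<gamma>\<close>, and a factor 1/2 since
      \<open>n = nat \<lfloor>T\<rfloor>\<close> is at least \<open>T / 2\<close> when
      \<open>T \<ge> 1\<close>.\<close>
    define \<kappa> where "\<kappa> = c * \<gamma> / 2"
    have "0 < \<kappa>" using \<open>0 < c\<close> \<gamma> by (simp add: \<kappa>_def)
    define q where "q n = prob {\<omega> \<in> space M. (\<Sum>k<n. indicator (swing_event K m k) \<omega>) \<le> \<gamma> * real n}" for n
    have bound: "prob {\<omega> \<in> space M. \<epsilon> < \<bar>lse f X N T \<omega> - \<theta>\<^sub>0\<bar>} \<le> q (nat \<lfloor>T\<rfloor>) + 9 * \<sigma>\<^sup>2 * C\<^sup>2 / (\<epsilon> * \<kappa>)\<^sup>2 / T"
      if "1 \<le> T" for T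
    proof -
      define n where "n = nat \<lfloor>T\<rfloor>"
      have "1 \<le> \<lfloor>T\<rfloor>" using that by simp
      then have n: "real n \<le> T" "T / 2 \<le> real n" unfolding n_def by linarith+
      let ?A = "{\<omega> \<in> space M. (\<Sum>k<n. indicator (swing_event K m k) \<omega>) \<le> \<gamma> * real n}"
      let ?B = "{\<omega> \<in> space M. \<epsilon> * (\<kappa> * T) < \<bar>N T \<omega> - \<theta>\<^sub>0 * Q T \<omega>\<bar>}"
      have [measurable]: "(\<lambda>\<omega>. N T \<omega> - \<theta>\<^sub>0 * Q T \<omega>) \<in> borel_measurable M" using Q_meas that by simp
      have [measurable]: "?A \<in> events" "?B \<in> events" by measurable
      \<comment> \<open>Almost surely off \<open>?A\<close> the denominator exceeds
        \<open>\<kappa> * T\<close>, so an estimation error above \<open>\<epsilon>\<close> forces a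
        numerator error above \<open>\<epsilon> * (\<kappa> * T)\<close>.\<close>
      have "prob {\<omega> \<in> space M. \<epsilon> < \<bar>lse f X N T \<omega> - \<theta>\<^sub>0\<bar>} \<le> prob (?A \<union> ?B)"
      proof (rule finite_measure_mono_AE)
        show "AE \<omega> in M. \<omega> \<in> {\<omega> \<in> space M. \<epsilon> < \<bar>lse f X N T \<omega> - \<theta>\<^sub>0\<bar>} \<longrightarrow> \<omega> \<in> ?A \<union> ?B"
          using Q_ge
        proof (eventually_elim, intro impI)
          fix \<omega> assume ge: "\<forall>T n. real n \<le> T \<longrightarrow> c * (\<Sum>k<n. indicator (swing_event K m k) \<omega>) \<le> Q T \<omega>"
            and \<omega>: "\<omega> \<in> {\<omega> \<in> space M. \<epsilon> < \<bar>lse f X N T \<omega> - \<theta>\<^sub>0\<bar>}"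
          show "\<omega> \<in> ?A \<union> ?B"
          proof (cases "\<omega> \<in> ?A")
            case False
            with \<omega> have "\<gamma> * real n < (\<Sum>k<n. indicator (swing_event K m k) \<omega>)" by simp
            then have "c * (\<gamma> * real n) < Q T \<omega>"
              using ge n(1) \<open>0 < c\<close> by (meson mult_strict_left_mono less_le_trans)
            moreover have "\<kappa> * T \<le> c * (\<gamma> * real n)"
              using mult_left_mono[OF n(2), of "c * \<gamma>"] \<open>0 < c\<close> \<gamma> by (simp add: \<kappa>_def mult.assoc)
            ultimately have Q: "\<kappa> * T < Q T \<omega>" by simp
            have "0 < \<kappa> * T" using \<open>0 < \<kappa>\<close> that by simp
            with Q have "0 < Q T \<omega>" by linarith
            then have "lse f X N T \<omega> = N T \<omega> / Q T \<omega>"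
              by (simp add: lse_def Q_def H_def Let_def)
            moreover have "\<bar>N T \<omega> / Q T \<omega> - \<theta>\<^sub>0\<bar> = \<bar>N T \<omega> - \<theta>\<^sub>0 * Q T \<omega>\<bar> / Q T \<omega>"
              using \<open>0 < Q T \<omega>\<close> by (simp add: abs_div_pos diff_divide_distrib)
            ultimately have "\<epsilon> < \<bar>N T \<omega> - \<theta>\<^sub>0 * Q T \<omega>\<bar> / Q T \<omega>"
              using \<omega> by simp
            then have "\<epsilon> * Q T \<omega> < \<bar>N T \<omega> - \<theta>\<^sub>0 * Q T \<omega>\<bar>"
              using \<open>0 < Q T \<omega>\<close> by (simp add: less_divide_eq)
            moreover have "\<epsilon> * (\<kappa> * T) \<le> \<epsilon> * Q T \<omega>"
              using Q \<open>0 < \<epsilon>\<close> by (intro mult_left_mono) auto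
            ultimately show ?thesis using \<omega> by simp
          qed simp
        qed
      qed measurable
      also have "\<dots> \<le> prob ?A + prob ?B" by (intro measure_Un_le) measurable
      also have "prob ?A = q (nat \<lfloor>T\<rfloor>)" by (simp add: q_def n_def)
      also have "prob ?B \<le> 9 * \<sigma>\<^sup>2 * C\<^sup>2 * T / (\<epsilon> * (\<kappa> * T))\<^sup>2"
        using that \<open>0 < \<epsilon>\<close> \<open>0 < \<kappa>\<close> by (intro error) auto
      also have "\<dots> = 9 * \<sigma>\<^sup>2 * C\<^sup>2 / (\<epsilon> * \<kappa>)\<^sup>2 / T"
        using that by (simp add: power2_eq_square)
      finally show ?thesis by simp
    qed
    have "((\<lambda>T. q (nat \<lfloor>T\<rfloor>)) \<longlongrightarrow> 0) at_top"
      using filterlim_compose[OF filterlim_nat_sequentially filterlim_floor_sequentially]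
      by (rule filterlim_compose[OF count[folded q_def]])
    moreover have "((\<lambda>T. 9 * \<sigma>\<^sup>2 * C\<^sup>2 / (\<epsilon> * \<kappa>)\<^sup>2 / T) \<longlongrightarrow> 0) at_top"
      by (intro tendsto_divide_0[OF tendsto_const] filterlim_at_top_imp_at_infinity filterlim_ident)
    ultimately have lim: "((\<lambda>T. q (nat \<lfloor>T\<rfloor>) + 9 * \<sigma>\<^sup>2 * C\<^sup>2 / (\<epsilon> * \<kappa>)\<^sup>2 / T) \<longlongrightarrow> 0) at_top"
      using tendsto_add_zero by blast
    have le: "\<forall>\<^sub>F T in at_top. prob {\<omega> \<in> space M. \<epsilon> < \<bar>lse f X N T \<omega> - \<theta>\<^sub>0\<bar>}
        \<le> q (nat \<lfloor>T\<rfloor>) + 9 * \<sigma>\<^sup>2 * C\<^sup>2 / (\<epsilon> * \<kappa>)\<^sup>2 / T"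
      using eventually_ge_at_top[of 1] by eventually_elim (rule bound)
    show "((\<lambda>T. prob {\<omega> \<in> space M. \<epsilon> < \<bar>lse f X N T \<omega> - \<theta>\<^sub>0\<bar>}) \<longlongrightarrow> 0) at_top"
      by (rule tendsto_sandwich[OF _ le tendsto_const lim]) simp
  qed
qed

end
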